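(* Let $d\in\mathbb{N}$ and let $(M_p)_{p\in\mathbb{N}_0}$ be a sequence of positive real numbers satisfying both of the following conditions: (1) condition $(M2)'$: there exist $A,H>0$ such that $M_{p+1}\le AH^{p}M_p$ for all $p\in\mathbb{N}_0$; (2) there is $H>0$ such that for any $C>0$ there is $B>0$ with $$s^{s/2}M_p\le BC^sH^{s+p}M_{s+p}\qquad\text{for all } s,p\in\mathbb{N}_0.$$ Then the space $\mathcal{S}_{(M_p)}(\mathbb{R}^d)$ is nuclear.
   Context: $\mathbb{N}_0=\mathbb{N}\cup\{0\}$, and $0^0=1$. The space is $$\mathcal{S}_{(M_p)}(\mathbb{R}^d):=\Big\{f\in C^\infty(\mathbb{R}^d):\ \text{for any } j\in\mathbb{N},\ \sup_{\alpha,\beta\in\mathbb{N}_0^d}\sup_{x\in\mathbb{R}^d}|x^\alpha D^\beta f(x)|\,\frac{j^{|\alpha+\beta|}}{M_{|\alpha+\beta|}}<+\infty\Big\},$$ endowed with the locally convex topology given by the displayed suprema as seminorms, $j\in\mathbb{N}$. Here $D^\beta=(-i)^{|\beta|}\partial^\beta$. *)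

theory Defs
  imports "HOL-Analysis.Analysis" "HOL-Library.Function_Algebras"
begin

section \<open>Locally convex spaces\<close>

text \<open>
  Complex vector spaces are given by an additive type \<open>'a\<close> together with a scalar multiplication
  \<open>smul\<close>; a space is a linear subspace \<open>E\<close> of it. Seminorms are functions on the whole type of which
  only the values on \<open>E\<close> matter.
\<close>

definition seminorm_on :: "(complex \<Rightarrow> 'a \<Rightarrow> 'a) \<Rightarrow> 'a::ab_group_add set \<Rightarrow> ('a \<Rightarrow> real) \<Rightarrow> bool" where
  "seminorm_on smul E p \<longleftrightarrow>
     (\<forall>x\<in>E. 0 \<le> p x) \<and>
     (\<forall>x\<in>E. \<forall>y\<in>E. p (x + y) \<le> p x + p y) \<and>
     (\<forall>c. \<forall>x\<in>E. p (smul c x) = norm c * p x)"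

text \<open>\<open>E\<close> itself is among the generating sets so that it is the carrier even when \<open>P\<close> is empty.\<close>

definition seminorm_topology :: "'a::ab_group_add set \<Rightarrow> ('a \<Rightarrow> real) set \<Rightarrow> 'a topology" where
  "seminorm_topology E P =
     topology_generated_by (insert E {{y\<in>E. p (y - x) < e} | p x e. p \<in> P \<and> x \<in> E \<and> 0 < e})"

definition locally_convex_space :: "(complex \<Rightarrow> 'a \<Rightarrow> 'a) \<Rightarrow> 'a::ab_group_add topology \<Rightarrow> bool" where
  "locally_convex_space smul T \<longleftrightarrow>
     vector_space smul \<and> module.subspace smul (topspace T) \<and> Hausdorff_space T \<and>
     (\<exists>P. (\<forall>p\<in>P. seminorm_on smul (topspace T) p) \<and> T = seminorm_topology (topspace T) P)"

definition continuous_seminorm :: "(complex \<Rightarrow> 'a \<Rightarrow> 'a) \<Rightarrow> 'a::ab_group_add topology \<Rightarrow> ('a \<Rightarrow> real) \<Rightarrow> bool" where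
  "continuous_seminorm smul T p \<longleftrightarrow>
     seminorm_on smul (topspace T) p \<and> continuous_map T euclideanreal p"


section \<open>Nuclear maps\<close>

definition complex_linear_on ::
    "(complex \<Rightarrow> 'a \<Rightarrow> 'a) \<Rightarrow> (complex \<Rightarrow> 'b \<Rightarrow> 'b) \<Rightarrow> 'a::ab_group_add set \<Rightarrow> ('a \<Rightarrow> 'b::ab_group_add) \<Rightarrow> bool" where
  "complex_linear_on s\<^sub>E s\<^sub>F E T \<longleftrightarrow>
     (\<forall>x\<in>E. \<forall>y\<in>E. T (x + y) = T x + T y) \<and> (\<forall>c. \<forall>x\<in>E. T (s\<^sub>E c x) = s\<^sub>F c (T x))"

definition bounded_functional ::
    "(complex \<Rightarrow> 'a \<Rightarrow> 'a) \<Rightarrow> 'a::ab_group_add set \<Rightarrow> ('a \<Rightarrow> real) \<Rightarrow> ('a \<Rightarrow> complex) \<Rightarrow> bool" where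
  "bounded_functional smul E p a \<longleftrightarrow>
     complex_linear_on smul (*) E a \<and> (\<exists>C. \<forall>x\<in>E. norm (a x) \<le> C * p x)"

definition dual_norm :: "'a set \<Rightarrow> ('a \<Rightarrow> real) \<Rightarrow> ('a \<Rightarrow> complex) \<Rightarrow> real" where
  "dual_norm E p a = (SUP x\<in>{x\<in>E. p x \<le> 1}. norm (a x))"

text \<open>
  Nuclearity of \<open>T : E \<rightarrow> F\<close>, i.e. \<open>T x = \<Sum>n. a n (x) z n\<close> with \<open>a n\<close> in the dual of \<open>E\<close>, \<open>z n\<close> in \<open>F\<close> and
  \<open>\<Sum>n. \<parallel>a n\<parallel> \<parallel>z n\<parallel> < \<infinity>\<close>. Both spaces are seminormed and stand for the normed spaces
  \<open>E / {q = 0}\<close> and \<open>F / {p = 0}\<close>: the functionals factor through the first quotient because they are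
  bounded by a multiple of \<open>q\<close>, and convergence with respect to \<open>p\<close> is convergence in the second.
\<close>

definition nuclear_map ::
    "(complex \<Rightarrow> 'a \<Rightarrow> 'a) \<Rightarrow> 'a::ab_group_add set \<Rightarrow> ('a \<Rightarrow> real) \<Rightarrow>
     (complex \<Rightarrow> 'b \<Rightarrow> 'b) \<Rightarrow> 'b::ab_group_add set \<Rightarrow> ('b \<Rightarrow> real) \<Rightarrow> ('a \<Rightarrow> 'b) \<Rightarrow> bool" where
  "nuclear_map s\<^sub>E E q s\<^sub>F F p T \<longleftrightarrow>
     T ` E \<subseteq> F \<and> complex_linear_on s\<^sub>E s\<^sub>F E T \<and>
     (\<exists>(a :: nat \<Rightarrow> 'a \<Rightarrow> complex) (z :: nat \<Rightarrow> 'b).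
        (\<forall>n. bounded_functional s\<^sub>E E q (a n)) \<and>
        (\<forall>n. z n \<in> F) \<and>
        summable (\<lambda>n. dual_norm E q (a n) * p (z n)) \<and>
        (\<forall>x\<in>E. (\<lambda>N. p (T x - (\<Sum>n<N. s\<^sub>F (a n x) (z n)))) \<longlonglongrightarrow> 0))"


section \<open>Local Banach spaces and nuclear spaces\<close>

text \<open>
  The completion of the seminormed space \<open>(E, p)\<close>: \<open>p\<close>-Cauchy sequences in \<open>E\<close> with pointwise
  operations and the limit of \<open>p\<close> as seminorm. Modulo the null sequences this is the local Banach
  space \<open>E\<^sub>p\<close>, the completion of \<open>E / {p = 0}\<close>; the quotient is left implicit as above.
\<close>

definition seq_completion :: "'a::ab_group_add set \<Rightarrow> ('a \<Rightarrow> real) \<Rightarrow> (nat \<Rightarrow> 'a) set" where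
  "seq_completion E p = {u. range u \<subseteq> E \<and> (\<forall>e>0. \<exists>N. \<forall>m\<ge>N. \<forall>n\<ge>N. p (u m - u n) < e)}"

definition seq_completion_norm :: "('a \<Rightarrow> real) \<Rightarrow> (nat \<Rightarrow> 'a) \<Rightarrow> real" where
  "seq_completion_norm p u = lim (\<lambda>n. p (u n))"

definition seq_completion_smul :: "(complex \<Rightarrow> 'a \<Rightarrow> 'a) \<Rightarrow> complex \<Rightarrow> (nat \<Rightarrow> 'a) \<Rightarrow> nat \<Rightarrow> 'a" where
  "seq_completion_smul smul c u = (\<lambda>n. smul c (u n))"

text \<open>
  For \<open>p \<le> q\<close> every \<open>q\<close>-Cauchy sequence is \<open>p\<close>-Cauchy, and the canonical map \<open>E\<^sub>q \<rightarrow> E\<^sub>p\<close> (the extension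
  of the identity of \<open>E\<close>) sends such a sequence to itself.
\<close>

definition nuclear_space :: "(complex \<Rightarrow> 'a \<Rightarrow> 'a) \<Rightarrow> 'a::ab_group_add topology \<Rightarrow> bool" where
  "nuclear_space smul T \<longleftrightarrow>
     locally_convex_space smul T \<and>
     (\<forall>p. continuous_seminorm smul T p \<longrightarrow>
        (\<exists>q. continuous_seminorm smul T q \<and> (\<forall>x\<in>topspace T. p x \<le> q x) \<and>
           nuclear_map
             (seq_completion_smul smul) (seq_completion (topspace T) q) (seq_completion_norm q)
             (seq_completion_smul smul) (seq_completion (topspace T) p) (seq_completion_norm p)
             (\<lambda>u. u)))"


section \<open>Multi-indices and derivatives\<close>

definition mi_abs :: "('d::finite \<Rightarrow> nat) \<Rightarrow> nat" where
  "mi_abs \<alpha> = (\<Sum>i\<in>UNIV. \<alpha> i)"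

definition mi_monomial :: "('d::finite \<Rightarrow> nat) \<Rightarrow> real ^ 'd \<Rightarrow> real" where
  "mi_monomial \<alpha> x = (\<Prod>i\<in>UNIV. (x $ i) ^ \<alpha> i)"

definition partial_deriv :: "'d::finite \<Rightarrow> (real ^ 'd \<Rightarrow> complex) \<Rightarrow> real ^ 'd \<Rightarrow> complex" where
  "partial_deriv i f x = frechet_derivative f (at x) (axis i 1)"

text \<open>\<open>f\<close> and all its iterated partial derivatives, in any order, are differentiable everywhere.\<close>

definition C_infinity :: "(real ^ 'd::finite \<Rightarrow> complex) \<Rightarrow> bool" where
  "C_infinity f \<longleftrightarrow> (\<forall>is x. foldr partial_deriv is f differentiable (at x))"

text \<open>
  \<open>\<partial>\<^sup>\<beta>\<close> differentiates \<open>\<beta> i\<close> times in direction \<open>i\<close>, for each \<open>i\<close> once along an arbitrary fixed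
  enumeration of the coordinates, whose order is irrelevant for smooth functions.
\<close>

definition coords :: "'d::finite list" where
  "coords = (SOME is. distinct is \<and> set is = UNIV)"

definition multi_deriv :: "('d::finite \<Rightarrow> nat) \<Rightarrow> (real ^ 'd \<Rightarrow> complex) \<Rightarrow> real ^ 'd \<Rightarrow> complex" where
  "multi_deriv \<beta> f = foldr (\<lambda>i. partial_deriv i ^^ \<beta> i) coords f"

definition D_deriv :: "('d::finite \<Rightarrow> nat) \<Rightarrow> (real ^ 'd \<Rightarrow> complex) \<Rightarrow> real ^ 'd \<Rightarrow> complex" where
  "D_deriv \<beta> f x = (- \<i>) ^ mi_abs \<beta> * multi_deriv \<beta> f x"


section \<open>The space of rapidly decreasing ultradifferentiable functions of Beurling type\<close>

definition S_weight ::
    "(nat \<Rightarrow> real) \<Rightarrow> nat \<Rightarrow> (real ^ 'd::finite \<Rightarrow> complex) \<Rightarrow>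
     ('d \<Rightarrow> nat) \<times> ('d \<Rightarrow> nat) \<times> (real ^ 'd) \<Rightarrow> real" where
  "S_weight M j f = (\<lambda>(\<alpha>, \<beta>, x).
     norm (of_real (mi_monomial \<alpha> x) * D_deriv \<beta> f x) *
       (real j ^ mi_abs (\<lambda>i. \<alpha> i + \<beta> i) / M (mi_abs (\<lambda>i. \<alpha> i + \<beta> i))))"

definition S_space :: "(nat \<Rightarrow> real) \<Rightarrow> (real ^ 'd::finite \<Rightarrow> complex) set" where
  "S_space M = {f. C_infinity f \<and> (\<forall>j\<ge>1. bdd_above (range (S_weight M j f)))}"

definition S_seminorm :: "(nat \<Rightarrow> real) \<Rightarrow> nat \<Rightarrow> (real ^ 'd::finite \<Rightarrow> complex) \<Rightarrow> real" where
  "S_seminorm M j f = (SUP t. S_weight M j f t)"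

definition S_topology :: "(nat \<Rightarrow> real) \<Rightarrow> (real ^ 'd::finite \<Rightarrow> complex) topology" where
  "S_topology M = seminorm_topology (S_space M) {S_seminorm M j | j. 1 \<le> j}"

definition fun_smul :: "complex \<Rightarrow> ('x \<Rightarrow> complex) \<Rightarrow> 'x \<Rightarrow> complex" where
  "fun_smul c f = (\<lambda>x. c * f x)"

end

theory Submission
  imports Defs "Jordan_Normal_Form.Determinant"
begin

text \<open>
  Nuclearity is read off from the decay of Gelfand numbers. Suppose that finitely many continuous
  functionals, growing with \<open>k\<close>, are such that on their common kernel \<open>p \<le> \<epsilon> k * q\<close>. Auerbach's
  lemma gives a projection along this kernel whose norm grows at most linearly in the number of
  functionals, so that if \<open>\<epsilon> k\<close> decays fast enough compared with these numbers, the telescoping sum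
  of the projections is a nuclear representation of the identity from \<open>q\<close> to \<open>p\<close>.

  For the space at hand the functionals are the derivatives of order less than \<open>(L + 1) k\<close> at the
  points of the grid of mesh \<open>2 ^ -k\<close> in the cube of radius \<open>2 ^ k\<close>. If they all vanish at \<open>f\<close>, then
  \<open>\<bar>x ^ \<alpha> D ^ \<beta> f(x)\<bar>\<close> is small: for large \<open>\<bar>\<alpha> + \<beta>\<bar>\<close> by comparing \<open>j\<close> with a larger index, for large \<open>x\<close>
  by spending \<open>L\<close> more powers of \<open>x\<close>, and otherwise by applying the mean value theorem \<open>L\<close> times
  from a nearby grid point; \<open>(M2)'\<close> absorbs the shift by \<open>L\<close>. This gives \<open>\<epsilon> k = O(2 ^ (-L k))\<close> against
  \<open>O(8 ^ (d k))\<close> functionals, and \<open>L = 6 d + 1\<close> suffices.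
\<close>

section \<open>Linear functionals and seminorms\<close>

lemma complex_linear_on_0:
  assumes "vector_space smul" "module.subspace smul E" "complex_linear_on smul (*) E a"
  shows "a 0 = 0"
proof -
  interpret vector_space smul by fact
  have "0 \<in> E" using assms(2) by (rule subspace_0)
  then have "a (smul 0 0) = 0 * a 0" using assms(3) unfolding complex_linear_on_def by blast
  then show ?thesis by simp
qed

lemma complex_linear_on_diff:
  assumes "vector_space smul" "module.subspace smul E" "complex_linear_on smul (*) E a"
    and "x \<in> E" "y \<in> E"
  shows "a (x - y) = a x - a y"
proof -
  interpret vector_space smul by fact
  have "x - y \<in> E" by (intro subspace_diff assms)
  then have "a ((x - y) + y) = a (x - y) + a y"
    using assms(3,5) unfolding complex_linear_on_def by blast
  then show ?thesis by simp
qed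

lemma complex_linear_on_sum:
  assumes "vector_space smul" "module.subspace smul E" "complex_linear_on smul (*) E a"
    and "\<And>k. k \<in> K \<Longrightarrow> x k \<in> E"
  shows "a (\<Sum>k\<in>K. smul (c k) (x k)) = (\<Sum>k\<in>K. c k * a (x k))"
proof -
  interpret vector_space smul by fact
  show ?thesis using assms(4)
  proof (induction K rule: infinite_finite_induct)
    case (insert k K)
    have "smul (c k) (x k) \<in> E" "(\<Sum>k\<in>K. smul (c k) (x k)) \<in> E"
      using insert.prems assms(2) by (auto intro!: subspace_scale subspace_sum)
    then show ?case
      using insert assms(3) unfolding complex_linear_on_def by auto
  qed (use complex_linear_on_0[OF assms(1-3)] in auto)
qed

lemma complex_linear_on_combination:
  assumes "\<And>i. i \<in> I \<Longrightarrow> complex_linear_on smul (*) E (l i)"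
  shows "complex_linear_on smul (*) E (\<lambda>y. \<Sum>i\<in>I. g i * l i y)"
  using assms unfolding complex_linear_on_def
  by (simp add: sum.distrib distrib_left sum_distrib_left mult.left_commute cong: sum.cong)

lemma seminorm_onD:
  assumes "seminorm_on smul E q" "x \<in> E"
  shows "0 \<le> q x" and "y \<in> E \<Longrightarrow> q (x + y) \<le> q x + q y" and "q (smul c x) = norm c * q x"
  using assms unfolding seminorm_on_def by blast+

lemma complex_linear_onD:
  assumes "complex_linear_on s\<^sub>E s\<^sub>F E T" "x \<in> E"
  shows "y \<in> E \<Longrightarrow> T (x + y) = T x + T y" and "T (s\<^sub>E c x) = s\<^sub>F c (T x)"
  using assms unfolding complex_linear_on_def by blast+

lemma seminorm_on_0:
  assumes "vector_space smul" "module.subspace smul E" "seminorm_on smul E q"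
  shows "q 0 = 0"
proof -
  interpret vector_space smul by fact
  have "0 \<in> E" using assms(2) by (rule subspace_0)
  then have "q (smul 0 0) = norm (0::complex) * q 0" using assms(3) unfolding seminorm_on_def by blast
  then show ?thesis by simp
qed

lemma seminorm_on_minus:
  assumes "vector_space smul" "module.subspace smul E" "seminorm_on smul E q" "x \<in> E"
  shows "q (- x) = q x"
proof -
  interpret vector_space smul by fact
  have "q (smul (-1) x) = norm (-1::complex) * q x" using assms(3,4) unfolding seminorm_on_def by blast
  then show ?thesis by simp
qed

lemma seminorm_on_diff:
  assumes "vector_space smul" "module.subspace smul E" "seminorm_on smul E q" "x \<in> E" "y \<in> E"
  shows "q (x - y) \<le> q x + q y"
proof -
  interpret vector_space smul by fact
  have "- y \<in> E" using assms by (intro subspace_neg)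
  then have "q (x + - y) \<le> q x + q (- y)" using assms(3,4) unfolding seminorm_on_def by blast
  then show ?thesis using seminorm_on_minus[OF assms(1-3,5)] by simp
qed

lemma seminorm_on_diff_diff:
  assumes "vector_space smul" "module.subspace smul E" "seminorm_on smul E q" "x \<in> E" "y \<in> E"
  shows "\<bar>q x - q y\<bar> \<le> q (x - y)"
proof -
  interpret vector_space smul by fact
  have d: "x - y \<in> E" "y - x \<in> E" using assms by (auto intro: subspace_diff)
  have "q ((x - y) + y) \<le> q (x - y) + q y" "q ((y - x) + x) \<le> q (y - x) + q x"
    using assms(3-5) d unfolding seminorm_on_def by blast+
  moreover have "q (y - x) = q (x - y)" using seminorm_on_minus[OF assms(1-3) d(1)] by simp
  ultimately show ?thesis by simp
qed

lemma seminorm_on_sum: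
  assumes "vector_space smul" "module.subspace smul E" "seminorm_on smul E q"
    and "\<And>k. k \<in> K \<Longrightarrow> x k \<in> E"
  shows "q (\<Sum>k\<in>K. smul (c k) (x k)) \<le> (\<Sum>k\<in>K. norm (c k) * q (x k))"
proof -
  interpret vector_space smul by fact
  show ?thesis using assms(4)
  proof (induction K rule: infinite_finite_induct)
    case (insert k K)
    have "smul (c k) (x k) \<in> E" "(\<Sum>k\<in>K. smul (c k) (x k)) \<in> E"
      using insert.prems assms(2) by (auto intro!: subspace_scale subspace_sum)
    then have "q (smul (c k) (x k) + (\<Sum>k\<in>K. smul (c k) (x k)))
        \<le> q (smul (c k) (x k)) + q (\<Sum>k\<in>K. smul (c k) (x k))"
      using assms(3) unfolding seminorm_on_def by blast
    moreover have "q (smul (c k) (x k)) = norm (c k) * q (x k)"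
      using insert.prems assms(3) unfolding seminorm_on_def by blast
    ultimately show ?case using insert by simp
  qed (use seminorm_on_0[OF assms(1-3)] in auto)
qed

section \<open>Auerbach's lemma\<close>

text \<open>In the Leibniz formula every product is at most \<open>C ^ n\<close>. What matters below
  is only that the determinants stay bounded on the unit ball, so the factorial is harmless.\<close>

lemma norm_det_le:
  fixes B :: "complex mat"
  assumes "B \<in> carrier_mat n n" "\<And>i j. i < n \<Longrightarrow> j < n \<Longrightarrow> norm (B $$ (i, j)) \<le> C"
  shows "norm (det B) \<le> real (card {p. p permutes {0..<n}}) * C ^ n"
proof -
  have "norm (signof p * (\<Prod>i = 0..<n. B $$ (i, p i))) \<le> C ^ n" if p: "p permutes {0..<n}" for p
  proof -
    have "norm (\<Prod>i = 0..<n. B $$ (i, p i)) \<le> (\<Prod>i = 0..<n. C)"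
      unfolding prod_norm[symmetric]
      by (intro prod_mono) (use assms(2) permutes_in_image[OF p] in auto)
    then show ?thesis by (simp add: norm_mult sign_def)
  qed
  then show ?thesis
    unfolding det_def'[OF assms(1)] by (intro order_trans[OF norm_sum] sum_bounded_above) auto
qed

text \<open>
  The points are chosen so that \<open>\<bar>det (l i (x j))\<bar>\<close> is at least half of its supremum over the unit
  ball; by Cramer's rule the coefficients \<open>c k y\<close> are quotients of two such determinants.
\<close>

lemma auerbach_biorthogonal:
  fixes l :: "nat \<Rightarrow> 'a::ab_group_add \<Rightarrow> complex"
  assumes vs: "vector_space smul" and E: "module.subspace smul E" and q: "seminorm_on smul E q"
    and l: "\<And>i. i < n \<Longrightarrow> bounded_functional smul E q (l i)"
    and y: "\<And>j. j < n \<Longrightarrow> y j \<in> E" "\<And>j. j < n \<Longrightarrow> l j (y j) \<noteq> 0"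
      "\<And>i j. i < n \<Longrightarrow> j < n \<Longrightarrow> i \<noteq> j \<Longrightarrow> l i (y j) = 0"
  obtains x g where "\<And>k. k < n \<Longrightarrow> x k \<in> E \<and> q (x k) \<le> 1"
    "\<And>k u. k < n \<Longrightarrow> u \<in> E \<Longrightarrow> norm (\<Sum>i<n. g k i * l i u) \<le> 2 * q u"
    "\<And>i u. i < n \<Longrightarrow> u \<in> E \<Longrightarrow> (\<Sum>k<n. (\<Sum>j<n. g k j * l j u) * l i (x k)) = l i u"
proof -
  interpret vector_space smul by fact
  have lin: "\<And>i. i < n \<Longrightarrow> complex_linear_on smul (*) E (l i)"
    using l unfolding bounded_functional_def by blast
  have "\<forall>i. \<exists>C. i < n \<longrightarrow> (\<forall>x\<in>E. norm (l i x) \<le> C * q x)"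
    using l unfolding bounded_functional_def by blast
  then obtain C where C: "\<And>i x. i < n \<Longrightarrow> x \<in> E \<Longrightarrow> norm (l i x) \<le> C i * q x" by metis
  have q0: "0 \<le> q x" if "x \<in> E" for x using q that unfolding seminorm_on_def by blast
  have qs: "q (smul c x) = norm c * q x" if "x \<in> E" for c x using q that unfolding seminorm_on_def by blast
  define C' where "C' = (\<Sum>i<n. \<bar>C i\<bar>)"
  have C': "norm (l i x) \<le> C'" if "i < n" "x \<in> E" "q x \<le> 1" for i x
  proof -
    have "norm (l i x) \<le> \<bar>C i\<bar> * q x"
      using C[OF that(1,2)] q0[OF that(2)] by (meson abs_ge_self mult_right_mono order_trans)
    also have "\<dots> \<le> \<bar>C i\<bar>" using that(3) q0[OF that(2)] by (simp add: mult_left_le)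
    also have "\<dots> \<le> C'" unfolding C'_def using that(1) by (intro member_le_sum) auto
    finally show ?thesis .
  qed
  define B where "B x = mat n n (\<lambda>(i, j). l i (x j))" for x :: "nat \<Rightarrow> 'a"
  have Bc[simp]: "B x \<in> carrier_mat n n" for x by (simp add: B_def)
  define X where "X = {x. \<forall>j<n. x j \<in> E \<and> q (x j) \<le> 1}"
  define S where "S = (\<lambda>x. norm (det (B x))) ` X"
  have bdd: "bdd_above S"
    unfolding S_def X_def B_def
    by (intro bdd_aboveI2[where M = "real (card {p. p permutes {0..<n}}) * C' ^ n"] norm_det_le)
      (auto intro: C')
  have Sup: "norm (det (B x)) \<le> Sup S" if "x \<in> X" for x
    using that bdd unfolding S_def by (auto intro: cSup_upper)
  have "0 < Sup S"
  proof -
    \<comment> \<open>Scaled into the unit ball, the biorthogonal vectors make \<open>B z\<close>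
      diagonal with nonzero entries. The summand \<open>1\<close> keeps the denominator positive
      without an appeal to \<open>0 < q (y j)\<close>.\<close>
    define z where "z j = smul (of_real (1 / (q (y j) + 1))) (y j)" for j
    have "z j \<in> E \<and> q (z j) \<le> 1" if "j < n" for j
      using y(1)[OF that] q0[OF y(1)[OF that]]
      by (auto simp: z_def qs norm_divide intro!: subspace_scale E)
    then have "z \<in> X" by (simp add: X_def)
    have *: "l i (z j) = of_real (1 / (q (y j) + 1)) * l i (y j)" if "i < n" "j < n" for i j
      using lin[OF that(1)] y(1)[OF that(2)] unfolding complex_linear_on_def z_def by blast
    have "upper_triangular (B z)" by (auto simp: B_def * y(3) upper_triangular_def)
    then have "det (B z) = prod_list (diag_mat (B z))"
      by (rule det_upper_triangular[where n = n]) simp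
    also have "\<dots> \<noteq> 0"
    proof -
      have "l i (z i) \<noteq> 0" if "i < n" for i
        unfolding *[OF that that] using y(2)[OF that] q0[OF y(1)[OF that]]
        by (metis add_nonneg_pos divide_eq_0_iff less_numeral_extra(1,3) mult_eq_0_iff of_real_eq_0_iff
          zero_neq_one)
      then show ?thesis by (auto simp: prod_list_zero_iff diag_mat_def B_def)
    qed
    finally have "0 < norm (det (B z))" by simp
    also have "\<dots> \<le> Sup S" by (rule Sup) fact
    finally show ?thesis .
  qed
  \<comment> \<open>In infinite dimension the supremum need not be attained; settling for half of it
    costs the factor \<open>2\<close> in the bound on the coefficients.\<close>
  then have "Sup S / 2 < Sup S" by simp
  moreover have "S \<noteq> {}"
    using subspace_0[OF E] seminorm_on_0[OF vs E q] by (auto simp: S_def X_def intro!: exI[of _ "\<lambda>_. 0"])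
  ultimately obtain x where x: "x \<in> X" and big: "Sup S / 2 < norm (det (B x))"
    using less_cSup_iff[OF _ bdd] unfolding S_def by blast
  define D where "D = det (B x)"
  have D: "D \<noteq> 0" using big \<open>0 < Sup S\<close> by (auto simp: D_def)
  \<comment> \<open>By the adjugate formula \<open>g\<close> is the inverse of the matrix
    \<open>B x\<close>, so \<open>w u\<close> solves the linear system with right-hand side
    \<open>b u\<close>.\<close>
  define g where "g k i = adj_mat (B x) $$ (k, i) / D" for k i
  define b where "b u = vec n (\<lambda>i. l i u)" for u
  define w where "w u = vec n (\<lambda>k. \<Sum>i<n. g k i * l i u)" for u
  have adj: "adj_mat (B x) \<in> carrier_mat n n" "B x * adj_mat (B x) = D \<cdot>\<^sub>m 1\<^sub>m n"
    using adj_mat[of "B x" n] by (auto simp: D_def)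
  have w: "w u = (1 / D) \<cdot>\<^sub>v (adj_mat (B x) *\<^sub>v b u)" for u
    using adj(1) by (intro eq_vecI)
      (auto simp: w_def b_def g_def scalar_prod_def sum_divide_distrib atLeast0LessThan)
  have Bw: "B x *\<^sub>v w u = b u" for u
  proof -
    have bc: "b u \<in> carrier_vec n" by (simp add: b_def)
    have "B x *\<^sub>v w u = (1 / D) \<cdot>\<^sub>v (B x *\<^sub>v (adj_mat (B x) *\<^sub>v b u))"
      unfolding w using adj(1) bc by (intro mult_mat_vec[where nr = n and nc = n]) auto
    also have "B x *\<^sub>v (adj_mat (B x) *\<^sub>v b u) = (B x * adj_mat (B x)) *\<^sub>v b u"
      by (rule assoc_mult_mat_vec[OF Bc adj(1) bc, symmetric])
    also have "\<dots> = D \<cdot>\<^sub>v (1\<^sub>m n *\<^sub>v b u)" unfolding adj(2) using bc by auto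
    also have "\<dots> = D \<cdot>\<^sub>v b u" using bc by simp
    finally show ?thesis using D by (simp add: smult_smult_assoc)
  qed
  \<comment> \<open>Replacing the point \<open>x k\<close> by \<open>u\<close> replaces column
    \<open>k\<close> of the matrix by \<open>b u\<close>, and Cramer's rule reads off the
    \<open>k\<close>-th coordinate of the solution.\<close>
  have cramer: "det (B (x(k := u))) = (\<Sum>i<n. g k i * l i u) * D" if "k < n" for k u
  proof -
    have "B (x(k := u)) = replace_col (B x) (B x *\<^sub>v w u) k"
      unfolding Bw by (intro eq_matI) (auto simp: replace_col_def B_def b_def)
    then have "det (B (x(k := u))) = w u $ k * det (B x)"
      using cramer_lemma_mat[of "B x" n "w u" k] that by (simp add: w_def)
    then show ?thesis using that by (simp add: w_def D_def)
  qed
  show ?thesis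
  proof (rule that)
    show "x k \<in> E \<and> q (x k) \<le> 1" if "k < n" for k using x that by (simp add: X_def)
    show "norm (\<Sum>i<n. g k i * l i u) \<le> 2 * q u" if k: "k < n" and u: "u \<in> E" for k u
    proof (cases "q u = 0")
      case True
      then have "l i u = 0" if "i < n" for i using C[OF that u] by simp
      then show ?thesis using True by simp
    next
      case False
      then have pos: "0 < q u" using q0[OF u] by simp
      define v where "v = smul (of_real (1 / q u)) u"
      have v: "v \<in> E" "q v = 1"
        using u pos by (auto simp: v_def qs norm_divide intro!: subspace_scale E)
      have "x(k := v) \<in> X" using x v by (auto simp: X_def)
      then have "norm ((\<Sum>i<n. g k i * l i v) * D) \<le> Sup S" using Sup cramer[OF k] by metis
      also have "\<dots> \<le> 2 * norm D" using big by (simp add: D_def)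
      finally have "norm (\<Sum>i<n. g k i * l i v) \<le> 2" using D by (simp add: norm_mult)
      moreover have "(\<Sum>i<n. g k i * l i v) = of_real (1 / q u) * (\<Sum>i<n. g k i * l i u)"
        using complex_linear_on_combination[of "{..<n}" smul E l "g k"] lin u
        unfolding complex_linear_on_def v_def by blast
      ultimately show ?thesis using pos by (simp add: norm_mult norm_divide field_simps)
    qed
    show "(\<Sum>k<n. (\<Sum>j<n. g k j * l j u) * l i (x k)) = l i u" if "i < n" "u \<in> E" for i u
    proof -
      have "(B x *\<^sub>v w u) $ i = (\<Sum>k<n. l i (x k) * (\<Sum>j<n. g k j * l j u))"
        using that by (simp add: B_def w_def scalar_prod_def atLeast0LessThan)
      then show ?thesis using that unfolding Bw by (simp add: b_def mult.commute)
    qed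
  qed
qed

lemma auerbach:
  fixes l :: "'i \<Rightarrow> 'a::ab_group_add \<Rightarrow> complex"
  assumes vs: "vector_space smul" and E: "module.subspace smul E" and q: "seminorm_on smul E q"
    and "finite I" and "\<And>i. i \<in> I \<Longrightarrow> bounded_functional smul E q (l i)"
  shows "\<exists>x c. (\<forall>k::nat. x k \<in> E \<and> q (x k) \<le> 1) \<and> (\<forall>k. complex_linear_on smul (*) E (c k)) \<and>
    (\<forall>k. \<forall>u\<in>E. norm (c k u) \<le> 2 * q u) \<and>
    (\<forall>u\<in>E. (\<forall>i\<in>I. l i u = 0) \<longrightarrow> (\<forall>k. c k u = 0)) \<and>
    (\<forall>u\<in>E. \<forall>i\<in>I. (\<Sum>k<card I. c k u * l i (x k)) = l i u)"
  using assms(4,5)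
proof (induction I rule: finite_psubset_induct)
  case (psubset I)
  interpret vector_space smul by fact
  have zero: "0 \<in> E" "q 0 = 0" using subspace_0[OF E] seminorm_on_0[OF vs E q] by auto
  show ?case
  proof (cases "\<forall>i\<in>I. \<exists>u\<in>E. l i u \<noteq> 0 \<and> (\<forall>j\<in>I - {i}. l j u = 0)")
    case True
    then obtain y where y: "\<And>i. i \<in> I \<Longrightarrow> y i \<in> E \<and> l i (y i) \<noteq> 0 \<and> (\<forall>j\<in>I - {i}. l j (y i) = 0)"
      by metis
    define n where "n = card I"
    obtain h where h: "bij_betw h {..<n} I"
      using ex_bij_betw_nat_finite[OF psubset.hyps] by (auto simp: n_def atLeast0LessThan)
    have hI: "h i \<in> I" if "i < n" for i using h that by (auto simp: bij_betw_def)
    have "l (h i) (y (h j)) = 0" if "i < n" "j < n" "i \<noteq> j" for i j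
      using y[OF hI[OF that(2)]] hI[OF that(1)] h that by (auto simp: bij_betw_def inj_on_def)
    then obtain x g where xg: "\<And>k. k < n \<Longrightarrow> x k \<in> E \<and> q (x k) \<le> 1"
      "\<And>k u. k < n \<Longrightarrow> u \<in> E \<Longrightarrow> norm (\<Sum>i<n. g k i * l (h i) u) \<le> 2 * q u"
      "\<And>i u. i < n \<Longrightarrow> u \<in> E \<Longrightarrow> (\<Sum>k<n. (\<Sum>j<n. g k j * l (h j) u) * l (h i) (x k)) = l (h i) u"
      using auerbach_biorthogonal[OF vs E q, of n "\<lambda>i. l (h i)" "\<lambda>i. y (h i)"] y hI psubset.prems
      by (smt (verit, ccfv_threshold))
    define x' where "x' k = (if k < n then x k else 0)" for k
    define c where "c k u = (if k < n then \<Sum>i<n. g k i * l (h i) u else 0)" for k u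
    have lin: "complex_linear_on smul (*) E (c k)" for k
      using complex_linear_on_combination[of "{..<n}" smul E "\<lambda>i. l (h i)" "g k"] psubset.prems hI
      by (cases "k < n") (auto simp: c_def bounded_functional_def complex_linear_on_def)
    moreover have "norm (c k u) \<le> 2 * q u" if "u \<in> E" for k u
      using xg(2)[of k u] that q by (auto simp: c_def seminorm_on_def)
    moreover have "(\<Sum>k<n. c k u * l i (x' k)) = l i u" if "u \<in> E" "i \<in> I" for i u
    proof -
      obtain j where "j < n" "i = h j" using h \<open>i \<in> I\<close> by (auto simp: bij_betw_def)
      then show ?thesis using xg(3)[of j u] that by (simp add: c_def x'_def)
    qed
    moreover have "x' k \<in> E \<and> q (x' k) \<le> 1" for k using xg(1) zero by (simp add: x'_def)
    moreover have "c k u = 0" if "\<forall>i\<in>I. l i u = 0" for k u using that hI by (simp add: c_def)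
    ultimately show ?thesis unfolding n_def[symmetric] by blast
  next
    case False
    then obtain i where i: "i \<in> I"
      and van: "\<And>u. u \<in> E \<Longrightarrow> (\<forall>j\<in>I - {i}. l j u = 0) \<Longrightarrow> l i u = 0" by blast
    have "I - {i} \<subset> I" using i by blast
    moreover have "bounded_functional smul E q (l j)" if "j \<in> I - {i}" for j
      using that psubset.prems by blast
    ultimately obtain x c where
      xc: "\<forall>k::nat. x k \<in> E \<and> q (x k) \<le> 1" "\<forall>k. complex_linear_on smul (*) E (c k)"
      "\<forall>k. \<forall>u\<in>E. norm (c k u) \<le> 2 * q u"
      "\<forall>u\<in>E. (\<forall>j\<in>I - {i}. l j u = 0) \<longrightarrow> (\<forall>k. c k u = 0)"
      "\<forall>u\<in>E. \<forall>j\<in>I - {i}. (\<Sum>k<card (I - {i}). c k u * l j (x k)) = l j u"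
      using psubset.IH[of "I - {i}"] by (elim exE conjE meta_impE) auto
    define m where "m = card (I - {i})"
    have m: "card I = Suc m" using i psubset.hyps card_Suc_Diff1 unfolding m_def by metis
    \<comment> \<open>Since \<open>card I = Suc m\<close>, the sum over \<open>k < card I\<close>
      has one more term than the system for \<open>I - {i}\<close>; the zero coefficient makes it
      vanish.\<close>
    define c' where "c' k = (if k < m then c k else (\<lambda>_. 0))" for k
    have lin: "complex_linear_on smul (*) E (c' k)" for k
      using xc(2) by (auto simp: c'_def complex_linear_on_def)
    have sum: "(\<Sum>k<card I. c' k u * l j (x k)) = (\<Sum>k<m. c k u * l j (x k))" for u j
      by (simp add: m c'_def)
    have eq: "(\<Sum>k<m. c k u * l j (x k)) = l j u" if u: "u \<in> E" and j: "j \<in> I" for u j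
    proof (cases "j = i")
      case True
      have linl: "complex_linear_on smul (*) E (l a)" if "a \<in> I" for a
        using psubset.prems[OF that] by (simp add: bounded_functional_def)
      \<comment> \<open>\<open>v\<close> is the projection of \<open>u\<close> built for
        \<open>I - {i}\<close>; as \<open>v - u\<close> is annihilated by all functionals other than
        \<open>l i\<close>, it is annihilated by \<open>l i\<close> too.\<close>
      define v where "v = (\<Sum>k<m. smul (c k u) (x k))"
      have v: "v \<in> E" unfolding v_def using xc(1) by (intro subspace_sum subspace_scale E) auto
      have lv: "l a v = (\<Sum>k<m. c k u * l a (x k))" if "a \<in> I" for a
        unfolding v_def using xc(1) by (intro complex_linear_on_sum[OF vs E linl[OF that]]) auto
      have "l a (v - u) = 0" if "a \<in> I - {i}" for a
        using complex_linear_on_diff[OF vs E linl v u, of a] lv[of a] that xc(5) u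
        by (simp add: m_def)
      then have "l i (v - u) = 0" using van[of "v - u"] subspace_diff[OF E v u] by blast
      then show ?thesis using complex_linear_on_diff[OF vs E linl[OF i] v u] lv[OF i] True by simp
    next
      case False
      then show ?thesis using xc(5) u j by (simp add: m_def)
    qed
    show ?thesis
      by (intro exI[of _ x] exI[of _ c'] conjI allI ballI)
        (use xc lin q sum eq in \<open>auto simp: c'_def seminorm_on_def\<close>)
  qed
qed


section \<open>Nuclear maps between completions\<close>

lemma sum_fun_apply: "(\<Sum>k\<in>K. f k) x = (\<Sum>k\<in>K. f k x)"
  by (induction K rule: infinite_finite_induct) auto

lemma seq_completionD:
  assumes "u \<in> seq_completion E q"
  shows "u m \<in> E" and "0 < e \<Longrightarrow> \<exists>N. \<forall>m\<ge>N. \<forall>n\<ge>N. q (u m - u n) < e"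
  using assms unfolding seq_completion_def by auto

text \<open>Constant sequences embed \<open>E\<close> isometrically into its completion; the vectors
  of a nuclear representation enter the completion in this way.\<close>

lemma seq_completion_const:
  assumes "vector_space smul" "module.subspace smul E" "seminorm_on smul E q" "z \<in> E"
  shows "(\<lambda>_. z) \<in> seq_completion E q" "seq_completion_norm q (\<lambda>_. z) = q z"
  using assms seminorm_on_0[OF assms(1-3)] by (auto simp: seq_completion_def seq_completion_norm_def)

text \<open>The reverse triangle inequality makes the real sequence Cauchy, so that the
  \<open>lim\<close> in \<open>seq_completion_norm\<close> is a genuine limit.\<close>

lemma seq_completion_norm_limit:
  assumes "vector_space smul" "module.subspace smul E" "seminorm_on smul E q"
    and u: "u \<in> seq_completion E q"
  shows "(\<lambda>m. q (u m)) \<longlonglongrightarrow> seq_completion_norm q u"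
proof -
  have uE: "u m \<in> E" for m using u by (auto simp: seq_completion_def)
  have "Cauchy (\<lambda>m. q (u m))"
  proof (rule metric_CauchyI)
    fix e :: real assume "0 < e"
    from seq_completionD(2)[OF u this]
    obtain N where "\<And>m n. m \<ge> N \<Longrightarrow> n \<ge> N \<Longrightarrow> q (u m - u n) < e" by metis
    then show "\<exists>N. \<forall>m\<ge>N. \<forall>n\<ge>N. dist (q (u m)) (q (u n)) < e"
      using seminorm_on_diff_diff[OF assms(1-3) uE uE]
      unfolding dist_real_def by (meson le_less_trans)
  qed
  then show ?thesis
    unfolding seq_completion_norm_def by (simp add: Cauchy_convergent_iff convergent_LIMSEQ_iff)
qed

lemma functional_limit:
  assumes vs: "vector_space smul" "module.subspace smul E" and q: "seminorm_on smul E q"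
    and a: "complex_linear_on smul (*) E a" "\<And>x. x \<in> E \<Longrightarrow> norm (a x) \<le> K * q x"
    and u: "u \<in> seq_completion E q"
  shows "(\<lambda>m. a (u m)) \<longlonglongrightarrow> lim (\<lambda>m. a (u m))"
proof -
  interpret vector_space smul by fact
  have uE: "u m \<in> E" for m using u by (auto simp: seq_completion_def)
  have "Cauchy (\<lambda>m. a (u m))"
  proof (rule metric_CauchyI)
    fix e :: real assume e: "0 < e"
    \<comment> \<open>The sign of \<open>K\<close> is open here; \<open>\<bar>K\<bar> + 1\<close> is
      a positive constant that dominates it.\<close>
    have "0 < \<bar>K\<bar> + 1" by linarith
    then have "0 < e / (\<bar>K\<bar> + 1)" using e by simp
    from seq_completionD(2)[OF u this]
    obtain N where N: "\<And>m n. m \<ge> N \<Longrightarrow> n \<ge> N \<Longrightarrow> q (u m - u n) < e / (\<bar>K\<bar> + 1)" by metis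
    have "dist (a (u m)) (a (u n)) < e" if "m \<ge> N" "n \<ge> N" for m n
    proof -
      have d: "u m - u n \<in> E" using uE by (intro subspace_diff vs)
      then have q0: "0 \<le> q (u m - u n)" using q by (simp add: seminorm_on_def)
      have "dist (a (u m)) (a (u n)) = norm (a (u m - u n))"
        by (simp add: dist_norm complex_linear_on_diff[OF vs a(1) uE uE])
      also have "\<dots> \<le> K * q (u m - u n)" using a(2)[OF d] .
      also have "\<dots> \<le> (\<bar>K\<bar> + 1) * q (u m - u n)" using q0 by (intro mult_right_mono) auto
      also have "\<dots> < e" using N[OF that] by (simp add: field_simps)
      finally show ?thesis .
    qed
    then show "\<exists>N. \<forall>m\<ge>N. \<forall>n\<ge>N. dist (a (u m)) (a (u n)) < e" by blast
  qed
  then show ?thesis by (simp add: Cauchy_convergent_iff convergent_LIMSEQ_iff)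
qed

lemma functional_completion:
  assumes vs: "vector_space smul" "module.subspace smul E" and q: "seminorm_on smul E q"
    and a: "complex_linear_on smul (*) E a" "\<And>x. x \<in> E \<Longrightarrow> norm (a x) \<le> K * q x" and "0 \<le> K"
  shows "bounded_functional (seq_completion_smul smul) (seq_completion E q) (seq_completion_norm q)
      (\<lambda>u. lim (\<lambda>m. a (u m)))" (is ?bdd)
    and "dual_norm (seq_completion E q) (seq_completion_norm q) (\<lambda>u. lim (\<lambda>m. a (u m))) \<in> {0..K}" (is ?dual)
proof -
  interpret vector_space smul by fact
  let ?E = "seq_completion E q" and ?q = "seq_completion_norm q"
  let ?a = "\<lambda>u. lim (\<lambda>m. a (u m))"
  note alim = functional_limit[OF vs q a]
  have "?a (u + v) = ?a u + ?a v" if "u \<in> ?E" "v \<in> ?E" for u v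
  proof (rule limI)
    have "a ((u + v) m) = a (u m) + a (v m)" for m
      using complex_linear_onD(1)[OF a(1) seq_completionD(1)[OF that(1)] seq_completionD(1)[OF that(2)]]
      by simp
    then show "(\<lambda>m. a ((u + v) m)) \<longlonglongrightarrow> ?a u + ?a v"
      using that by (auto intro!: tendsto_intros alim)
  qed
  moreover have "?a (seq_completion_smul smul c u) = c * ?a u" if "u \<in> ?E" for c u
  proof (rule limI)
    have "a (seq_completion_smul smul c u m) = c * a (u m)" for m
      using complex_linear_onD(2)[OF a(1) seq_completionD(1)[OF that]]
      by (simp add: seq_completion_smul_def)
    then show "(\<lambda>m. a (seq_completion_smul smul c u m)) \<longlonglongrightarrow> c * ?a u"
      using that by (auto intro!: tendsto_intros alim)
  qed
  ultimately have lin: "complex_linear_on (seq_completion_smul smul) (*) ?E ?a"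
    by (simp add: complex_linear_on_def)
  have bound: "norm (?a u) \<le> K * ?q u" if "u \<in> ?E" for u
  proof (rule LIMSEQ_le)
    show "(\<lambda>m. norm (a (u m))) \<longlonglongrightarrow> norm (?a u)" by (intro tendsto_norm alim that)
    show "(\<lambda>m. K * q (u m)) \<longlonglongrightarrow> K * ?q u"
      by (intro tendsto_mult_left seq_completion_norm_limit[OF vs q that])
    show "\<exists>N. \<forall>m\<ge>N. norm (a (u m)) \<le> K * q (u m)"
      using that by (auto simp: seq_completion_def intro!: a(2))
  qed
  show ?bdd unfolding bounded_functional_def using lin bound by blast
  \<comment> \<open>The zero sequence shows that the supremum in \<open>dual_norm\<close> ranges
    over a nonempty set, which both bounds on it rely on.\<close>
  have z: "(\<lambda>_. 0) \<in> {u \<in> ?E. ?q u \<le> 1}"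
    using seq_completion_const[OF vs q subspace_0[OF vs(2)]] seminorm_on_0[OF vs q] by simp
  have le: "norm (?a u) \<le> K" if "u \<in> {u \<in> ?E. ?q u \<le> 1}" for u
  proof -
    have "norm (?a u) \<le> K * ?q u" using that bound by blast
    also have "\<dots> \<le> K * 1" using that \<open>0 \<le> K\<close> by (intro mult_left_mono) auto
    finally show ?thesis by simp
  qed
  have "0 \<le> norm (?a (\<lambda>_. 0))" by simp
  also have "\<dots> \<le> dual_norm ?E ?q ?a"
    unfolding dual_norm_def by (rule cSUP_upper[OF z]) (use le in \<open>auto intro!: bdd_aboveI2\<close>)
  finally have "0 \<le> dual_norm ?E ?q ?a" .
  moreover have "dual_norm ?E ?q ?a \<le> K"
    unfolding dual_norm_def using z by (intro cSUP_least le) blast+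
  ultimately show ?dual by simp
qed

text \<open>As \<open>t\<close> does not depend on \<open>x\<close>, the estimate of the remainder
  passes to the limit along a \<open>q\<close>-Cauchy sequence and yields convergence of the
  extended series on the whole completion.\<close>

lemma nuclear_map_completionI:
  assumes vs: "vector_space smul" "module.subspace smul E"
    and p: "seminorm_on smul E p" and q: "seminorm_on smul E q" and pq: "\<And>x. x \<in> E \<Longrightarrow> p x \<le> q x"
    and a: "\<And>n. complex_linear_on smul (*) E (a n)"
      "\<And>n x. x \<in> E \<Longrightarrow> norm (a n x) \<le> K n * q x" "\<And>n. 0 \<le> K n"
    and z: "\<And>n. z n \<in> E" "summable (\<lambda>n. K n * p (z n))"
    and t: "t \<longlonglongrightarrow> 0" "\<And>x N. x \<in> E \<Longrightarrow> p (x - (\<Sum>n<N. smul (a n x) (z n))) \<le> t N * q x"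
  shows "nuclear_map (seq_completion_smul smul) (seq_completion E q) (seq_completion_norm q)
    (seq_completion_smul smul) (seq_completion E p) (seq_completion_norm p) (\<lambda>u. u)"
proof -
  interpret vector_space smul by fact
  let ?Eq = "seq_completion E q" and ?q = "seq_completion_norm q"
  let ?p = "seq_completion_norm p"
  define b where "b n u = lim (\<lambda>m. a n (u m))" for n and u :: "nat \<Rightarrow> 'a"
  have p0: "0 \<le> p x" if "x \<in> E" for x using that p by (simp add: seminorm_on_def)
  have sub: "?Eq \<subseteq> seq_completion E p"
  proof
    fix u assume u: "u \<in> ?Eq"
    have le: "p (u m - u n) \<le> q (u m - u n)" for m n
      by (intro pq subspace_diff[OF vs(2)] seq_completionD[OF u])
    have "\<exists>N. \<forall>m\<ge>N. \<forall>n\<ge>N. p (u m - u n) < e" if "0 < e" for e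
      using seq_completionD(2)[OF u that] le by (meson le_less_trans)
    then show "u \<in> seq_completion E p"
      using seq_completionD(1)[OF u] by (auto simp: seq_completion_def)
  qed
  have b: "bounded_functional (seq_completion_smul smul) ?Eq ?q (b n)" "dual_norm ?Eq ?q (b n) \<in> {0..K n}" for n
    using functional_completion[OF vs q a(1), of n "K n"] a unfolding b_def by auto
  have "(\<lambda>N. ?p (u - (\<Sum>n<N. seq_completion_smul smul (b n u) (\<lambda>_. z n)))) \<longlonglongrightarrow> 0" if u: "u \<in> ?Eq" for u
  proof -
    have uE: "u m \<in> E" for m using u by (auto simp: seq_completion_def)
    have "norm (?p (u - (\<Sum>n<N. seq_completion_smul smul (b n u) (\<lambda>_. z n)))) \<le> t N * ?q u" for N
    proof -
      let ?s = "\<Sum>n<N. smul (b n u) (z n)"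
      let ?v = "u - (\<Sum>n<N. seq_completion_smul smul (b n u) (\<lambda>_. z n))"
      have v: "?v m = u m - ?s" for m by (simp add: sum_fun_apply seq_completion_smul_def)
      have sE: "?s \<in> E" by (intro subspace_sum subspace_scale vs z)
      have "u \<in> seq_completion E p" using u sub by blast
      then have "?v \<in> seq_completion E p"
        using subspace_diff[OF vs(2) uE sE] unfolding seq_completion_def mem_Collect_eq v
        by (auto simp: v simp del: minus_apply)
      from seq_completion_norm_limit[OF vs p this]
      have lim: "(\<lambda>m. p (u m - ?s)) \<longlonglongrightarrow> ?p ?v" by (simp only: v)
      \<comment> \<open>The last sum is zero. It is written out as the limit of the error made by
        replacing \<open>b n u\<close> by \<open>a n (u m)\<close>, so that the estimate can be
        proved for each \<open>m\<close> first.\<close>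
      have "?p ?v \<le> t N * ?q u + (\<Sum>n<N. norm (b n u - b n u) * p (z n))"
      proof (rule LIMSEQ_le[OF lim])
        have "(\<lambda>m. a n (u m)) \<longlonglongrightarrow> b n u" for n
          unfolding b_def by (rule functional_limit[OF vs q a(1,2) u])
        then show "(\<lambda>m. t N * q (u m) + (\<Sum>n<N. norm (a n (u m) - b n u) * p (z n)))
            \<longlonglongrightarrow> t N * ?q u + (\<Sum>n<N. norm (b n u - b n u) * p (z n))"
          by (intro tendsto_intros seq_completion_norm_limit[OF vs q u])
        have "p (u m - ?s) \<le> t N * q (u m) + (\<Sum>n<N. norm (a n (u m) - b n u) * p (z n))" for m
        proof -
          let ?r = "\<Sum>n<N. smul (a n (u m)) (z n)"
          let ?d = "\<Sum>n<N. smul (a n (u m) - b n u) (z n)"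
          have rE: "?r \<in> E" "?d \<in> E" by (intro subspace_sum subspace_scale vs z)+
          have "u m - ?s = (u m - ?r) + ?d"
            by (simp add: scale_left_diff_distrib sum_subtractf)
          then have "p (u m - ?s) \<le> p (u m - ?r) + p ?d"
            using seminorm_onD(2)[OF p subspace_diff[OF vs(2) uE rE(1)] rE(2)] by (simp only:)
          moreover have "p ?d \<le> (\<Sum>n<N. norm (a n (u m) - b n u) * p (z n))"
            by (rule seminorm_on_sum[OF vs p z(1)])
          ultimately show ?thesis using t(2)[OF uE, of m N] by linarith
        qed
        then show "\<exists>M. \<forall>m\<ge>M. p (u m - ?s) \<le> t N * q (u m) + (\<Sum>n<N. norm (a n (u m) - b n u) * p (z n))"
          by blast
      qed
      moreover have "0 \<le> ?p ?v"
        by (rule LIMSEQ_le_const[OF lim]) (auto intro!: p0 subspace_diff vs uE sE)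
      ultimately show ?thesis by simp
    qed
    moreover have "(\<lambda>N. t N * ?q u) \<longlonglongrightarrow> 0" using tendsto_mult_left_zero[OF t(1)] by simp
    ultimately show ?thesis by (rule Lim_null_comparison[OF always_eventually[OF allI]])
  qed
  moreover have "summable (\<lambda>n. dual_norm ?Eq ?q (b n) * ?p (\<lambda>_. z n))"
  proof (rule summable_comparison_test'[OF z(2)])
    fix n
    show "norm (dual_norm ?Eq ?q (b n) * ?p (\<lambda>_. z n)) \<le> K n * p (z n)"
      using b(2)[of n] p0[OF z(1)[of n]]
      by (simp add: seq_completion_const(2)[OF vs p z(1)] abs_mult mult_right_mono)
  qed
  moreover have "complex_linear_on (seq_completion_smul smul) (seq_completion_smul smul) ?Eq (\<lambda>u. u)"
    by (simp add: complex_linear_on_def)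
  ultimately show ?thesis
    unfolding nuclear_map_def using sub b(1) seq_completion_const(1)[OF vs p z(1)]
    by (intro conjI exI[of _ b] exI[of _ "\<lambda>n _. z n"]) auto
qed

section \<open>Nuclear representations from nested kernels of functionals\<close>

lemma summable_tail_tendsto_0:
  fixes T :: "nat \<Rightarrow> real"
  assumes "summable T"
  shows "(\<lambda>M. \<Sum>m. T (m + M)) \<longlonglongrightarrow> 0"
proof -
  have "(\<lambda>M. suminf T - (\<Sum>m<M. T m)) \<longlonglongrightarrow> suminf T - suminf T"
    by (intro tendsto_intros summable_LIMSEQ assms)
  then show ?thesis by (simp add: suminf_minus_initial_segment[OF assms])
qed

lemma sum_le_suminf_tail:
  fixes T :: "nat \<Rightarrow> real"
  assumes "summable T" "\<And>m. 0 \<le> T m" "finite W" "W \<subseteq> {M..}"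
  shows "sum T W \<le> (\<Sum>m. T (m + M))"
proof -
  have "sum T W = (\<Sum>m\<in>(\<lambda>m. m - M) ` W. T (m + M))"
    using assms(4) by (subst sum.reindex) (auto intro!: inj_on_diff_nat sum.cong simp: subset_eq)
  also have "\<dots> \<le> (\<Sum>m. T (m + M))"
    using assms by (intro sum_le_suminf summable_ignore_initial_segment) auto
  finally show ?thesis .
qed

text \<open>
  With Auerbach projections \<open>P k\<close> along the common kernels, nestedness gives
  \<open>P k \<circ> P (Suc k) = P k\<close>, so that \<open>P (Suc k) - P k\<close> maps \<open>u\<close> to the sum over \<open>i\<close> of
  \<open>c (Suc k) i u\<close> times \<open>x (Suc k) i - P k (x (Suc k) i)\<close>, where the last vector is small because
  it lies in the kernel of level \<open>k\<close>.
\<close>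

lemma nuclear_map_from_kernels:
  fixes l :: "'i \<Rightarrow> 'a::ab_group_add \<Rightarrow> complex"
  assumes vs: "vector_space smul" "module.subspace smul E"
    and p: "seminorm_on smul E p" and q: "seminorm_on smul E q" and pq: "\<And>x. x \<in> E \<Longrightarrow> p x \<le> q x"
    and I: "I 0 = {}" "\<And>k. finite (I k)" "\<And>k. I k \<subseteq> I (Suc k)"
    and l: "\<And>k i. i \<in> I k \<Longrightarrow> bounded_functional smul E q (l i)"
    and \<epsilon>: "\<And>k. 0 \<le> \<epsilon> k" "\<And>k x. x \<in> E \<Longrightarrow> (\<And>i. i \<in> I k \<Longrightarrow> l i x = 0) \<Longrightarrow> p x \<le> \<epsilon> k * q x"
    and N: "\<And>k. real (card (I k)) \<le> N k" "\<And>k. 1 \<le> N k" "summable (\<lambda>k. N k * N (Suc k) * \<epsilon> k)"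
  shows "nuclear_map (seq_completion_smul smul) (seq_completion E q) (seq_completion_norm q)
    (seq_completion_smul smul) (seq_completion E p) (seq_completion_norm p) (\<lambda>u. u)"
proof -
  interpret vector_space smul by fact
  define n where "n k = card (I k)" for k
  obtain x c where x: "\<And>k i. x k i \<in> E" "\<And>k i. q (x k i) \<le> 1"
    and c: "\<And>k i. complex_linear_on smul (*) E (c k i)"
      "\<And>k i u. u \<in> E \<Longrightarrow> norm (c k i u) \<le> 2 * q u"
      "\<And>k i u. u \<in> E \<Longrightarrow> (\<And>j. j \<in> I k \<Longrightarrow> l j u = 0) \<Longrightarrow> c k i u = 0"
    and rep: "\<And>k u j. u \<in> E \<Longrightarrow> j \<in> I k \<Longrightarrow> (\<Sum>i<n k. c k i u * l j (x k i)) = l j u"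
  proof -
    \<comment> \<open>Points and coefficients are packed into one pair so that a single
      \<open>choice\<close> over \<open>k\<close> yields both families.\<close>
    have "\<exists>y. (\<forall>i::nat. fst y i \<in> E \<and> q (fst y i) \<le> 1) \<and> (\<forall>i. complex_linear_on smul (*) E (snd y i)) \<and>
      (\<forall>i. \<forall>u\<in>E. norm (snd y i u) \<le> 2 * q u) \<and>
      (\<forall>u\<in>E. (\<forall>j\<in>I k. l j u = 0) \<longrightarrow> (\<forall>i. snd y i u = 0)) \<and>
      (\<forall>u\<in>E. \<forall>j\<in>I k. (\<Sum>i<n k. snd y i u * l j (fst y i)) = l j u)" (is "\<exists>y. ?R k y") for k
      unfolding n_def split_paired_Ex fst_conv snd_conv by (rule auerbach[OF vs q I(2) l])
    then obtain y where "\<forall>k. ?R k (y k)" using choice[of ?R] by auto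
    then show ?thesis by (intro that[of "\<lambda>k. fst (y k)" "\<lambda>k. snd (y k)"]) blast+
  qed
  have lin: "complex_linear_on smul (*) E (l j)" if "j \<in> I k" for j k
    using l[OF that] by (simp add: bounded_functional_def)
  have q0: "0 \<le> q u" if "u \<in> E" for u using seminorm_onD(1)[OF q that] .
  have p0: "0 \<le> p u" if "u \<in> E" for u using seminorm_onD(1)[OF p that] .
  have N0: "0 \<le> N k" for k using N(2)[of k] by simp
  define P where "P k u = (\<Sum>i<n k. smul (c k i u) (x k i))" for k u
  have PE: "P k u \<in> E" for k u unfolding P_def by (intro subspace_sum subspace_scale vs x)
  have lP: "l j (P k u) = l j u" if "u \<in> E" "j \<in> I k" for k u j
    unfolding P_def complex_linear_on_sum[OF vs lin[OF that(2)] x(1)] by (rule rep[OF that])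
  \<comment> \<open>The difference \<open>u - P k u\<close> lies in the kernel of level
    \<open>k\<close>. Its \<open>q\<close>-value is at most \<open>(1 + 2 * N k) * q u\<close>, and
    \<open>1 \<le> N k\<close> turns the bracket into \<open>3 * N k\<close>.\<close>
  have Pdiff: "p (u - P k u) \<le> 3 * \<epsilon> k * N k * q u" if u: "u \<in> E" for k u
  proof -
    have "l j (u - P k u) = 0" if "j \<in> I k" for j
      using complex_linear_on_diff[OF vs lin[OF that] u PE] lP[OF u that] by simp
    then have "p (u - P k u) \<le> \<epsilon> k * q (u - P k u)"
      by (intro \<epsilon>(2) subspace_diff vs u PE)
    also have "q (u - P k u) \<le> q u + q (P k u)" by (rule seminorm_on_diff[OF vs q u PE])
    also have "q (P k u) \<le> (\<Sum>i<n k. norm (c k i u) * q (x k i))"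
      unfolding P_def by (rule seminorm_on_sum[OF vs q x(1)])
    also have "\<dots> \<le> (\<Sum>i<n k. 2 * q u * 1)"
      by (intro sum_mono mult_mono c x u q0) (auto simp: q0 u)
    also have "\<dots> = n k * (2 * q u)" by simp
    also have "\<dots> \<le> N k * (2 * q u)" using N(1) q0[OF u] by (intro mult_right_mono) (auto simp: n_def)
    also have "q u + N k * (2 * q u) \<le> 3 * N k * q u"
      using mult_right_mono[OF N(2)[of k] q0[OF u]] by simp
    finally show ?thesis using \<epsilon>(1) by (simp add: mult_left_mono mult.assoc mult.left_commute)
  qed
  have cP: "c k i (P (Suc k) u) = c k i u" if u: "u \<in> E" for k i u
  proof -
    have "l j (P (Suc k) u - u) = 0" if "j \<in> I k" for j
    proof -
      have "j \<in> I (Suc k)" using I(3) that by blast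
      then show ?thesis using complex_linear_on_diff[OF vs lin PE u] lP[OF u] by simp
    qed
    then have "c k i (P (Suc k) u - u) = 0" by (intro c(3) subspace_diff vs PE u)
    then show ?thesis using complex_linear_on_diff[OF vs c(1) PE u] by simp
  qed
  define z where "z k i = x (Suc k) i - P k (x (Suc k) i)" for k i
  have zE: "z k i \<in> E" for k i unfolding z_def by (intro subspace_diff vs x PE)
  have block: "(\<Sum>i<n (Suc k). smul (c (Suc k) i u) (z k i)) = P (Suc k) u - P k u" if u: "u \<in> E" for k u
  proof -
    have "(\<Sum>i<n (Suc k). smul (c (Suc k) i u) (P k (x (Suc k) i)))
        = (\<Sum>i<n (Suc k). \<Sum>j<n k. smul (c (Suc k) i u * c k j (x (Suc k) i)) (x k j))"
      by (simp add: P_def scale_sum_right)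
    also have "\<dots> = (\<Sum>j<n k. smul (\<Sum>i<n (Suc k). c (Suc k) i u * c k j (x (Suc k) i)) (x k j))"
      by (subst sum.swap) (simp add: scale_sum_left)
    also have "\<dots> = P k (P (Suc k) u)"
      unfolding P_def[of k] by (simp add: P_def[of "Suc k"] complex_linear_on_sum[OF vs c(1) x(1)])
    also have "\<dots> = P k u" unfolding P_def[of k] by (simp add: cP[OF u])
    finally show ?thesis
      by (simp add: z_def scale_right_diff_distrib sum_subtractf P_def[of "Suc k"])
  qed
  \<comment> \<open>Summing the blocks telescopes; the starting value \<open>P 0 u\<close> is zero
    because \<open>I 0\<close> is empty.\<close>
  have blocks: "(\<Sum>(k, i)\<in>(SIGMA k:{..<K}. {..<n (Suc k)}). smul (c (Suc k) i u) (z k i)) = P K u"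
    if u: "u \<in> E" for K u
  proof -
    have "P 0 u = 0" by (simp add: P_def n_def I(1))
    then show ?thesis
      using sum_lessThan_telescope[of "\<lambda>k. P k u" K]
      by (subst sum.Sigma[symmetric]) (auto simp: block[OF u])
  qed
  define B where "B = (SIGMA k:UNIV. {..<n (Suc k)})"
  \<comment> \<open>A single sequence is obtained by decoding \<open>m\<close> into level and
    position; pairs outside \<open>B\<close> carry the zero functional and the bound
    \<open>K m = 0\<close>.\<close>
  define a where "a m u = (case prod_decode m of (k, i) \<Rightarrow> if (k, i) \<in> B then c (Suc k) i u else 0)" for m u
  define K where "K m = (if prod_decode m \<in> B then 2 else 0 :: real)" for m
  define w where "w m = (case prod_decode m of (k, i) \<Rightarrow> z k i)" for m
  define T where "T m = K m * p (w m)" for m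
  have wE: "w m \<in> E" for m by (auto simp: w_def zE split: prod.split)
  have T0: "0 \<le> T m" for m by (simp add: T_def K_def p0 wE)
  have aK: "norm (a m u) \<le> K m * q u" if "u \<in> E" for m u
    using c(2)[OF that] by (auto simp: a_def K_def split: prod.split)
  have T: "summable T"
  proof (rule summableI_nonneg_bounded[OF T0])
    fix M
    \<comment> \<open>The factor \<open>6\<close> is the bound \<open>2\<close> on the coefficients
      times the \<open>3\<close> of \<open>Pdiff\<close>, which is applied to vectors with
      \<open>q (x (Suc k) i) \<le> 1\<close>.\<close>
    define h where "h = (\<lambda>(k, i). if i < n (Suc k) then 6 * (\<epsilon> k * N k) else 0)"
    have h0: "0 \<le> h y" for y using \<epsilon>(1) N0 by (auto simp: h_def split: prod.split)
    have "T m \<le> h (prod_decode m)" for m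
    proof (cases "prod_decode m")
      case (Pair k i)
      have "p (z k i) \<le> 3 * \<epsilon> k * N k * q (x (Suc k) i)" unfolding z_def by (rule Pdiff[OF x(1)])
      also have "\<dots> \<le> 3 * \<epsilon> k * N k * 1" using \<epsilon>(1) N0 x(2) by (intro mult_left_mono) auto
      finally show ?thesis using Pair by (auto simp: T_def K_def w_def h_def B_def ac_simps)
    qed
    then have "sum T {..<M} \<le> (\<Sum>m<M. h (prod_decode m))" by (rule sum_mono)
    also have "\<dots> = sum h (prod_decode ` {..<M})"
      by (subst sum.reindex) (auto intro: inj_on_subset[OF inj_prod_decode])
    also have "\<dots> \<le> sum h ({..<M} \<times> {..<M})"
    proof (intro sum_mono2 h0)
      \<comment> \<open>Both components of a decoded pair are at most its code, so the first
        \<open>M\<close> codes fall into a square of side \<open>M\<close>.\<close>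
      have "fst (prod_decode m) \<le> m" "snd (prod_decode m) \<le> m" for m
        using le_prod_encode_1 le_prod_encode_2 prod_decode_inverse by (metis prod.collapse)+
      from this[THEN le_less_trans] show "prod_decode ` {..<M} \<subseteq> {..<M} \<times> {..<M}"
        by (intro image_subsetI) (simp add: mem_Times_iff)
    qed auto
    also have "\<dots> = (\<Sum>k<M. \<Sum>i<M. h (k, i))" by (simp add: sum.cartesian_product)
    also have "\<dots> \<le> (\<Sum>k<M. 6 * (N k * N (Suc k) * \<epsilon> k))"
    proof (rule sum_mono)
      fix k
      have "(\<Sum>i<M. h (k, i)) = (\<Sum>i\<in>{..<M} \<inter> {..<n (Suc k)}. 6 * (\<epsilon> k * N k))"
        unfolding h_def by (simp add: sum.inter_restrict del: sum_constant)
      also have "\<dots> \<le> (\<Sum>i<n (Suc k). 6 * (\<epsilon> k * N k))"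
        using \<epsilon>(1) N0 by (intro sum_mono2) auto
      also have "\<dots> = n (Suc k) * (6 * (\<epsilon> k * N k))" by simp
      also have "\<dots> \<le> N (Suc k) * (6 * (\<epsilon> k * N k))"
        using N(1) \<epsilon>(1) N0 by (intro mult_right_mono) (auto simp: n_def)
      finally show "(\<Sum>i<M. h (k, i)) \<le> 6 * (N k * N (Suc k) * \<epsilon> k)" by (simp add: ac_simps)
    qed
    also have "\<dots> = 6 * (\<Sum>k<M. N k * N (Suc k) * \<epsilon> k)" by (simp add: sum_distrib_left)
    also have "\<dots> \<le> 6 * (\<Sum>k. N k * N (Suc k) * \<epsilon> k)"
      using \<epsilon>(1) N0 by (intro mult_left_mono sum_le_suminf N) auto
    finally show "sum T {..<M} \<le> 6 * (\<Sum>k. N k * N (Suc k) * \<epsilon> k)" .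
  qed
  have tail: "p (u - (\<Sum>m<M. smul (a m u) (w m))) \<le> (\<Sum>m. T (m + M)) * q u" if u: "u \<in> E" for u M
  proof -
    let ?s = "\<Sum>m<M. smul (a m u) (w m)" and ?t = "\<Sum>m. T (m + M)"
    have sE: "?s \<in> E" by (intro subspace_sum subspace_scale vs wE)
    \<comment> \<open>The partial sum up to \<open>M\<close> is compared with \<open>P k u\<close>
      for \<open>k \<ge> M\<close>: all nonzero terms with code below \<open>M\<close> already occur
      in \<open>P k u\<close>, and its other terms have codes at least \<open>M\<close> and are
      controlled by the tail. Letting \<open>k\<close> grow then removes the distance from
      \<open>u\<close> to \<open>P k u\<close>.\<close>
    have "p (u - ?s) \<le> 3 * (N k * N (Suc k) * \<epsilon> k) * q u + ?t * q u" if k: "k \<ge> M" for k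
    proof -
      define W where "W = prod_encode ` (SIGMA k:{..<k}. {..<n (Suc k)})"
      have W: "finite W" by (simp add: W_def)
      have "P k u = (\<Sum>m\<in>W. smul (a m u) (w m))"
        unfolding W_def blocks[OF u, of k, symmetric]
        by (subst sum.reindex) (auto intro: inj_prod_encode inj_on_subset simp: a_def w_def B_def split_beta intro!: sum.cong)
      also have "\<dots> = (\<Sum>m\<in>W \<inter> {..<M}. smul (a m u) (w m)) + (\<Sum>m\<in>W - {..<M}. smul (a m u) (w m))"
        by (subst sum.union_disjoint[symmetric]) (use W in \<open>auto simp: Int_Diff_Un\<close>)
      also have "(\<Sum>m\<in>W \<inter> {..<M}. smul (a m u) (w m)) = ?s"
      proof (rule sum.mono_neutral_left)
        show "\<forall>m\<in>{..<M} - W \<inter> {..<M}. smul (a m u) (w m) = 0"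
        proof
          fix m assume m: "m \<in> {..<M} - W \<inter> {..<M}"
          obtain k' i where ki: "prod_decode m = (k', i)" by (cases "prod_decode m")
          then have mm: "m = prod_encode (k', i)" by (metis prod_decode_inverse)
          then have "k' \<le> m" using le_prod_encode_1 by simp
          then have "k' < k" using m k by auto
          then have "\<not> i < n (Suc k')" using m mm by (auto simp: W_def)
          then show "smul (a m u) (w m) = 0" by (simp add: a_def ki B_def)
        qed
      qed auto
      finally have eq: "P k u - ?s = (\<Sum>m\<in>W - {..<M}. smul (a m u) (w m))" by simp
      have "p (P k u - ?s) \<le> (\<Sum>m\<in>W - {..<M}. norm (a m u) * p (w m))"
        unfolding eq by (rule seminorm_on_sum[OF vs p wE])
      also have "\<dots> \<le> (\<Sum>m\<in>W - {..<M}. T m * q u)"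
      proof (rule sum_mono)
        fix m show "norm (a m u) * p (w m) \<le> T m * q u"
          using mult_right_mono[OF aK[OF u] p0[OF wE]] by (simp add: T_def ac_simps)
      qed
      also have "\<dots> = sum T (W - {..<M}) * q u" by (simp add: sum_distrib_right)
      also have "\<dots> \<le> ?t * q u"
        by (intro mult_right_mono sum_le_suminf_tail T T0 q0 u) (use W in auto)
      finally have "p (P k u - ?s) \<le> ?t * q u" .
      moreover have "p (u - P k u) \<le> 3 * (N k * N (Suc k) * \<epsilon> k) * q u"
      proof -
        have "\<epsilon> k * N k * 1 \<le> \<epsilon> k * N k * N (Suc k)" using \<epsilon>(1) N0 N(2) by (intro mult_left_mono) auto
        then have "3 * \<epsilon> k * N k * q u \<le> 3 * (N k * N (Suc k) * \<epsilon> k) * q u"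
          by (intro mult_right_mono q0 u) (simp add: ac_simps)
        then show ?thesis using Pdiff[OF u, of k] by linarith
      qed
      moreover have "p (u - ?s) \<le> p (u - P k u) + p (P k u - ?s)"
        using seminorm_onD(2)[OF p subspace_diff[OF vs(2) u PE[of k u]] subspace_diff[OF vs(2) PE[of k u] sE]] by simp
      ultimately show ?thesis by linarith
    qed
    moreover have "(\<lambda>k. 3 * (N k * N (Suc k) * \<epsilon> k) * q u + ?t * q u) \<longlonglongrightarrow> 3 * 0 * q u + ?t * q u"
      by (intro tendsto_intros summable_LIMSEQ_zero N)
    ultimately show ?thesis by (intro LIMSEQ_le_const[where X = "\<lambda>k. 3 * (N k * N (Suc k) * \<epsilon> k) * q u + ?t * q u"]) auto
  qed
  have "complex_linear_on smul (*) E (a m)" for m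
  proof (cases "prod_decode m")
    case (Pair k i)
    then have "a m = (if (k, i) \<in> B then c (Suc k) i else (\<lambda>_. 0))" by (auto simp: a_def)
    then show ?thesis using c(1) by (auto simp: complex_linear_on_def)
  qed
  moreover have "0 \<le> K m" for m by (simp add: K_def)
  moreover have "summable (\<lambda>m. K m * p (w m))" using T by (simp add: T_def[abs_def])
  ultimately show ?thesis
    using summable_tail_tendsto_0[OF T] aK tail
    by (intro nuclear_map_completionI[OF vs p q pq, where a = a and z = w and K = K and
      t = "\<lambda>M. \<Sum>m. T (m + M)"]) (auto simp: wE)
qed


section \<open>Topologies generated by seminorms\<close>

lemma topspace_seminorm_topology [simp]: "topspace (seminorm_topology E P) = E"
  unfolding seminorm_topology_def topology_generated_by_topspace by auto

lemma openin_seminorm_ball: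
  assumes "p \<in> P" "x \<in> E" "0 < e"
  shows "openin (seminorm_topology E P) {y \<in> E. p (y - x) < e}"
  unfolding seminorm_topology_def by (rule topology_generated_by_Basis) (use assms in blast)

text \<open>The induction over generated open sets uses that the family is directed: a ball for a
  common upper bound fits into the intersection of two balls. Some member of \<open>P\<close> must
  exist in order to find a ball inside the generating set \<open>E\<close>.\<close>

lemma openin_seminorm_topology_ball:
  assumes vs: "vector_space smul" "module.subspace smul E"
    and P: "\<And>p. p \<in> P \<Longrightarrow> seminorm_on smul E p" "P \<noteq> {}"
    and dir: "\<And>p p'. p \<in> P \<Longrightarrow> p' \<in> P \<Longrightarrow> \<exists>r\<in>P. \<forall>x\<in>E. p x \<le> r x \<and> p' x \<le> r x"
    and "openin (seminorm_topology E P) U" "x \<in> U"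
  shows "\<exists>p\<in>P. \<exists>e>0. {y \<in> E. p (y - x) < e} \<subseteq> U"
proof -
  interpret vector_space smul by fact
  let ?S = "insert E {{y\<in>E. p (y - x) < e} | p x e. p \<in> P \<and> x \<in> E \<and> 0 < e}"
  have "generate_topology_on ?S U"
    using assms(6) unfolding seminorm_topology_def by (rule openin_topology_generated_by)
  then show ?thesis using \<open>x \<in> U\<close>
  proof (induction U)
    case Empty
    then show ?case by simp
  next
    case (Int U V)
    have "x \<in> U" "x \<in> V" using Int.prems by auto
    from Int.IH(1)[OF this(1)] Int.IH(2)[OF this(2)]
    obtain p e p' e' where pe: "p \<in> P" "0 < e" "{y \<in> E. p (y - x) < e} \<subseteq> U"
      "p' \<in> P" "0 < e'" "{y \<in> E. p' (y - x) < e'} \<subseteq> V" by (elim bexE exE conjE)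
    have "generate_topology_on ?S (U \<inter> V)" using Int.hyps by (rule generate_topology_on.Int)
    then have "openin (seminorm_topology E P) (U \<inter> V)"
      unfolding seminorm_topology_def by (simp add: openin_topology_generated_by_iff)
    then have xE: "x \<in> E" using openin_subset Int.prems by fastforce
    obtain r where r: "r \<in> P" "\<forall>x\<in>E. p x \<le> r x \<and> p' x \<le> r x" using dir[OF pe(1,4)] by blast
    have "{y \<in> E. r (y - x) < min e e'} \<subseteq> U \<inter> V"
    proof
      fix y assume y: "y \<in> {y \<in> E. r (y - x) < min e e'}"
      then have "y - x \<in> E" using xE by (auto intro: subspace_diff vs)
      with r(2) have "p (y - x) \<le> r (y - x)" "p' (y - x) \<le> r (y - x)" by blast+
      with y have "y \<in> {y \<in> E. p (y - x) < e}" "y \<in> {y \<in> E. p' (y - x) < e'}" by auto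
      then show "y \<in> U \<inter> V" using pe(3,6) by blast
    qed
    moreover have "0 < min e e'" using pe by simp
    ultimately show ?case using r(1) by blast
  next
    case (UN K)
    then obtain k where "k \<in> K" "x \<in> k" by blast
    with UN.IH[of k] show ?case by (meson Union_upper order_trans)
  next
    case (Basis B)
    then consider "B = E" | p z e where "B = {y\<in>E. p (y - z) < e}" "p \<in> P" "z \<in> E" "0 < e" by blast
    then show ?case
    proof cases
      case 1
      obtain p where "p \<in> P" using P(2) by blast
      then show ?thesis using 1 by (intro bexI[of _ p] exI[of _ 1]) auto
    next
      case 2
      have x: "x \<in> E" "p (x - z) < e" using Basis.prems 2 by auto
      have "{y \<in> E. p (y - x) < e - p (x - z)} \<subseteq> B"
      proof
        fix y assume y: "y \<in> {y \<in> E. p (y - x) < e - p (x - z)}"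
        then have "p (y - x + (x - z)) \<le> p (y - x) + p (x - z)"
          using 2 x by (intro seminorm_onD(2)[OF P(1)] subspace_diff vs) auto
        then show "y \<in> B" using y 2 by simp
      qed
      then show ?thesis using 2(2) x(2) by (intro bexI[of _ p] exI[of _ "e - p (x - z)"]) auto
    qed
  qed
qed

lemma continuous_seminorm_scaled:
  assumes vs: "vector_space smul" "module.subspace smul E"
    and r: "r \<in> P" "seminorm_on smul E r" and C: "0 \<le> C"
  shows "continuous_seminorm smul (seminorm_topology E P) (\<lambda>x. C * r x)"
proof -
  have "seminorm_on smul E (\<lambda>x. C * r x)"
    using seminorm_onD[OF r(2)] C unfolding seminorm_on_def
    by (simp add: mult.left_commute mult_left_mono flip: distrib_left)
  moreover have "continuous_map (seminorm_topology E P) euclideanreal r"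
    unfolding continuous_map_def topspace_seminorm_topology
  proof (intro conjI allI impI)
    fix V :: "real set" assume "openin euclidean V"
    then have V: "open V" by simp
    show "openin (seminorm_topology E P) {x \<in> E. r x \<in> V}"
    proof (subst openin_subopen, intro ballI)
      fix x assume x: "x \<in> {x \<in> E. r x \<in> V}"
      then obtain e where e: "0 < e" "ball (r x) e \<subseteq> V" using V open_contains_ball by blast
      have "{y \<in> E. r (y - x) < e} \<subseteq> {x \<in> E. r x \<in> V}"
      proof
        fix y assume y: "y \<in> {y \<in> E. r (y - x) < e}"
        then have "\<bar>r y - r x\<bar> < e"
          using seminorm_on_diff_diff[OF vs r(2), of y x] x by auto
        then have "r y \<in> ball (r x) e" by (simp add: dist_real_def abs_minus_commute)
        then show "y \<in> {x \<in> E. r x \<in> V}" using e y by blast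
      qed
      moreover have "x \<in> {y \<in> E. r (y - x) < e}" using x e seminorm_on_0[OF vs r(2)] by simp
      ultimately show "\<exists>T. openin (seminorm_topology E P) T \<and> x \<in> T \<and> T \<subseteq> {x \<in> E. r x \<in> V}"
        using openin_seminorm_ball[OF r(1), of x E e] x e(1) by blast
    qed
  qed auto
  ultimately show ?thesis
    unfolding continuous_seminorm_def by (simp add: continuous_map_real_mult_left)
qed

text \<open>Continuity at zero provides a ball of some \<open>r\<close> on which \<open>p\<close>
  stays below \<open>1\<close>; homogeneity turns this into a bound on all of
  \<open>E\<close>.\<close>

lemma continuous_seminorm_bound:
  assumes vs: "vector_space smul" "module.subspace smul E"
    and P: "\<And>p. p \<in> P \<Longrightarrow> seminorm_on smul E p" "P \<noteq> {}"
    and dir: "\<And>p p'. p \<in> P \<Longrightarrow> p' \<in> P \<Longrightarrow> \<exists>r\<in>P. \<forall>x\<in>E. p x \<le> r x \<and> p' x \<le> r x"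
    and cont: "continuous_seminorm smul (seminorm_topology E P) p"
  shows "\<exists>r\<in>P. \<exists>C>0. \<forall>x\<in>E. p x \<le> C * r x"
proof -
  interpret vector_space smul by fact
  have p: "seminorm_on smul E p" and pc: "continuous_map (seminorm_topology E P) euclideanreal p"
    using cont by (auto simp: continuous_seminorm_def)
  have "openin (seminorm_topology E P) {x \<in> E. p x \<in> {..<1}}"
    using openin_continuous_map_preimage[OF pc, of "{..<1}"] by simp
  moreover have "0 \<in> {x \<in> E. p x \<in> {..<1}}"
    using seminorm_on_0[OF vs p] subspace_0[OF vs(2)] by simp
  ultimately obtain r e where r: "r \<in> P" and e: "0 < e" and sub: "{y \<in> E. r (y - 0) < e} \<subseteq> {x \<in> E. p x \<in> {..<1}}"
    using openin_seminorm_topology_ball[OF vs P dir, of "{x \<in> E. p x \<in> {..<1}}" 0] by blast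
  note rs = P(1)[OF r]
  have scaled: "t * p x < 1" if x: "x \<in> E" and t: "0 < t" "t * r x < e" for x and t :: real
  proof -
    let ?y = "smul (of_real t) x"
    have "?y \<in> E" by (intro subspace_scale vs x)
    moreover have "r ?y = t * r x" "p ?y = t * p x"
      using seminorm_onD(3)[OF rs x] seminorm_onD(3)[OF p x] t by auto
    ultimately show ?thesis using sub t by auto
  qed
  have "p x \<le> 2 / e * r x" if x: "x \<in> E" for x
  proof (rule ccontr)
    assume neg: "\<not> p x \<le> 2 / e * r x"
    have "0 \<le> 2 / e * r x" using seminorm_onD(1)[OF rs x] e by simp
    with neg have pos: "0 < p x" by linarith
    \<comment> \<open>Scaling \<open>x\<close> by \<open>1 / p x\<close> would land in the ball of
      radius \<open>e\<close> for \<open>r\<close>, while \<open>p\<close> takes the value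
      \<open>1\<close> there.\<close>
    have "2 * r x < e * p x" using neg e by (simp add: field_simps)
    moreover have "0 < e * p x" using pos e by simp
    ultimately have "1 / p x * r x < e" using pos by (simp add: field_simps)
    then show False using scaled[OF x, of "1 / p x"] pos by simp
  qed
  then show ?thesis using r e by (intro bexI[of _ r] exI[of _ "2 / e"]) auto
qed

lemma Hausdorff_seminorm_topology:
  assumes vs: "vector_space smul" "module.subspace smul E"
    and P: "\<And>p. p \<in> P \<Longrightarrow> seminorm_on smul E p"
    and sep: "\<And>x. x \<in> E \<Longrightarrow> x \<noteq> 0 \<Longrightarrow> \<exists>p\<in>P. p x \<noteq> 0"
  shows "Hausdorff_space (seminorm_topology E P)"
  unfolding Hausdorff_space_def topspace_seminorm_topology
proof (intro allI impI, elim conjE)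
  interpret vector_space smul by fact
  fix x y assume xy: "x \<in> E" "y \<in> E" "x \<noteq> y"
  have d: "y - x \<in> E" by (intro subspace_diff vs xy)
  then obtain p where p: "p \<in> P" "p (y - x) \<noteq> 0" using sep[of "y - x"] xy by auto
  define e where "e = p (y - x) / 2"
  have e: "0 < e" using p(2) seminorm_onD(1)[OF P[OF p(1)] d] by (simp add: e_def)
  have "disjnt {z \<in> E. p (z - x) < e} {z \<in> E. p (z - y) < e}"
  proof (rule ccontr)
    assume "\<not> ?thesis"
    then obtain z where z: "z \<in> E" "p (z - x) < e" "p (z - y) < e" by (auto simp: disjnt_iff)
    have "p (y - x) = p ((z - x) - (z - y))" by simp
    also have "\<dots> \<le> p (z - x) + p (z - y)"
      by (intro seminorm_on_diff[OF vs P[OF p(1)]] subspace_diff vs z xy)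
    finally show False using z by (simp add: e_def)
  qed
  moreover have "x \<in> {z \<in> E. p (z - x) < e}" "y \<in> {z \<in> E. p (z - y) < e}"
    using xy e seminorm_on_0[OF vs P[OF p(1)]] by auto
  ultimately show "\<exists>U V. openin (seminorm_topology E P) U \<and> openin (seminorm_topology E P) V \<and>
      x \<in> U \<and> y \<in> V \<and> disjnt U V"
    using openin_seminorm_ball[OF p(1) xy(1) e] openin_seminorm_ball[OF p(1) xy(2) e] by blast
qed


section \<open>Iterated partial derivatives\<close>

text \<open>
  The second difference is the increment over \<open>{0..h}\<close> of the function \<open>s \<mapsto> f (x + s u + h v) - f (x + s u)\<close>,
  whose derivative is \<open>h * G v + o(h)\<close>. Its symmetry in \<open>u\<close> and \<open>v\<close> yields the symmetry of mixed
  partial derivatives.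
\<close>

lemma second_difference:
  fixes f :: "'a::real_normed_vector \<Rightarrow> 'b::real_normed_vector"
  assumes f: "\<And>y. (f has_derivative f' y) (at y)"
    and G: "((\<lambda>y. f' y u) has_derivative G) (at x)" and e: "0 < e"
  shows "\<forall>\<^sub>F h in at_right 0. norm (f (x + h *\<^sub>R u + h *\<^sub>R v) - f (x + h *\<^sub>R u) - f (x + h *\<^sub>R v) + f x
    - h\<^sup>2 *\<^sub>R G v) \<le> e * h\<^sup>2"
proof -
  \<comment> \<open>For \<open>s\<close> and \<open>t\<close> between \<open>0\<close> and
    \<open>h\<close>, the displacement \<open>s *\<^sub>R u + t *\<^sub>R v\<close> has norm at most
    \<open>h * c\<close>; the summand \<open>1\<close> makes \<open>c\<close> positive. The
    denominator \<open>2 * c\<close> in \<open>e'\<close> splits the error between two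
    points.\<close>
  define c where "c = norm u + norm v + 1"
  have c: "0 < c" by (simp add: c_def add_nonneg_pos)
  define e' where "e' = e / (2 * c)"
  have e': "0 < e'" using e c by (simp add: e'_def)
  obtain d where d: "0 < d" and dG: "\<And>y. norm (y - x) < d \<Longrightarrow>
      norm (f' y u - f' x u - G (y - x)) \<le> e' * norm (y - x)"
    using G e' unfolding has_derivative_at_alt by blast
  interpret G: linear G using G by (rule has_derivative_linear)
  have "norm (f (x + h *\<^sub>R u + h *\<^sub>R v) - f (x + h *\<^sub>R u) - f (x + h *\<^sub>R v) + f x - h\<^sup>2 *\<^sub>R G v) \<le> e * h\<^sup>2"
    if h: "0 < h" "h < d / c" for h
  proof -
    \<comment> \<open>The expected linear part \<open>s *\<^sub>R h *\<^sub>R G v\<close> is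
      subtracted in advance, so that the derivative of \<open>\<psi>\<close> is pure error.\<close>
    define \<psi> where "\<psi> s = f (x + s *\<^sub>R u + h *\<^sub>R v) - f (x + s *\<^sub>R u) - s *\<^sub>R h *\<^sub>R G v" for s
    define \<psi>' where "\<psi>' s r = f' (x + s *\<^sub>R u + h *\<^sub>R v) (r *\<^sub>R u) - f' (x + s *\<^sub>R u) (r *\<^sub>R u) - r *\<^sub>R h *\<^sub>R G v" for s r
    have der: "(\<psi> has_derivative \<psi>' s) (at s within {0..h})" for s
      unfolding \<psi>_def \<psi>'_def
      by (auto intro!: derivative_eq_intros has_derivative_compose[OF _ f])
    have bound: "onorm (\<psi>' s) \<le> e * h" if s: "s \<in> {0..h}" for s
    proof (rule onorm_le)
      fix r :: real
      have le: "norm (s *\<^sub>R u + t *\<^sub>R v) \<le> h * c" if "t \<in> {0..h}" for t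
      proof -
        have "norm (s *\<^sub>R u + t *\<^sub>R v) \<le> s * norm u + t * norm v"
          using s that norm_triangle_ineq[of "s *\<^sub>R u" "t *\<^sub>R v"] by simp
        also have "\<dots> \<le> h * norm u + h * norm v" using s that by (intro add_mono mult_right_mono) auto
        also have "\<dots> \<le> h * c" using h by (simp add: c_def algebra_simps)
        finally show ?thesis .
      qed
      have hc: "h * c < d" using h c by (simp add: field_simps)
      have est: "norm (f' (x + (s *\<^sub>R u + t *\<^sub>R v)) u - f' x u - G (s *\<^sub>R u + t *\<^sub>R v)) \<le> e' * (h * c)"
        if "t \<in> {0..h}" for t
        using dG[of "x + (s *\<^sub>R u + t *\<^sub>R v)"] le[OF that] hc e'
        by (smt (verit, best) add_diff_cancel_left' mult_left_mono)
      have lin: "linear (f' y)" for y using f by (rule has_derivative_linear)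
      have "\<psi>' s r = r *\<^sub>R (f' (x + (s *\<^sub>R u + h *\<^sub>R v)) u - f' (x + s *\<^sub>R u) u - h *\<^sub>R G v)"
        by (simp add: \<psi>'_def linear_scale[OF lin] algebra_simps)
      \<comment> \<open>Both brackets are linearization errors of \<open>\<lambda>y. f' y u\<close>
        at \<open>x\<close>, the second one for \<open>t = 0\<close>; linearity of \<open>G\<close>
        leaves only \<open>h *\<^sub>R G v\<close>.\<close>
      also have "f' (x + (s *\<^sub>R u + h *\<^sub>R v)) u - f' (x + s *\<^sub>R u) u - h *\<^sub>R G v
        = (f' (x + (s *\<^sub>R u + h *\<^sub>R v)) u - f' x u - G (s *\<^sub>R u + h *\<^sub>R v))
          - (f' (x + (s *\<^sub>R u + 0 *\<^sub>R v)) u - f' x u - G (s *\<^sub>R u + 0 *\<^sub>R v))"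
        by (simp add: G.add G.scale)
      finally have "norm (\<psi>' s r) \<le> \<bar>r\<bar> * (e' * (h * c) + e' * (h * c))"
        using order_trans[OF norm_triangle_ineq4 add_mono[OF est[of h] est[of 0]]] h
        by (simp only: norm_scaleR) (rule mult_left_mono, auto)
      also have "\<dots> = e * h * norm r" using c by (simp add: e'_def)
      finally show "norm (\<psi>' s r) \<le> e * h * norm r" .
    qed
    have "norm (\<psi> h - \<psi> 0) \<le> e * h * norm (h - 0)"
      by (rule differentiable_bound[OF _ der bound]) (use h in auto)
    then show ?thesis using h by (simp add: \<psi>_def power2_eq_square algebra_simps)
  qed
  moreover have "\<forall>\<^sub>F h in at_right 0. 0 < h \<and> h < d / c"
    unfolding eventually_at_right_field using divide_pos_pos[OF d c] by blast
  ultimately show ?thesis by (auto elim!: eventually_mono)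
qed

lemma symmetric_second_derivative:
  fixes f :: "'a::real_normed_vector \<Rightarrow> 'b::real_normed_vector"
  assumes f: "\<And>y. (f has_derivative f' y) (at y)"
    and G: "((\<lambda>y. f' y u) has_derivative G) (at x)" and K: "((\<lambda>y. f' y v) has_derivative K) (at x)"
  shows "G v = K u"
proof (rule ccontr)
  assume ne: "G v \<noteq> K u"
  \<comment> \<open>With a third of the distance the two errors sum to
    \<open>2 * e * h\<^sup>2\<close>, which is below \<open>3 * e * h\<^sup>2\<close>, the norm of
    \<open>h\<^sup>2 *\<^sub>R (G v - K u)\<close>.\<close>
  define e where "e = norm (G v - K u) / 3"
  have e: "0 < e" using ne by (simp add: e_def)
  have "\<forall>\<^sub>F h in at_right (0::real). False"
    using second_difference[OF f G e, of v] second_difference[OF f K e, of u] eventually_at_right_less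
  proof eventually_elim
    case (elim h)
    let ?D = "f (x + h *\<^sub>R u + h *\<^sub>R v) - f (x + h *\<^sub>R u) - f (x + h *\<^sub>R v) + f x"
    have "f (x + h *\<^sub>R v + h *\<^sub>R u) - f (x + h *\<^sub>R v) - f (x + h *\<^sub>R u) + f x = ?D"
      by (simp add: algebra_simps)
    note elim(2)[unfolded this]
    from order_trans[OF norm_triangle_ineq4 add_mono[OF this elim(1)]]
    have "norm ((?D - h\<^sup>2 *\<^sub>R K u) - (?D - h\<^sup>2 *\<^sub>R G v)) \<le> e * h\<^sup>2 + e * h\<^sup>2" .
    also have "(?D - h\<^sup>2 *\<^sub>R K u) - (?D - h\<^sup>2 *\<^sub>R G v) = h\<^sup>2 *\<^sub>R (G v - K u)"
      by (simp add: algebra_simps)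
    finally have "h\<^sup>2 * (3 * e) \<le> h\<^sup>2 * (2 * e)" by (simp add: e_def)
    then show False using elim(3) e by simp
  qed
  then show False by simp
qed

section \<open>Commuting partial derivatives and multi-indices\<close>

lemma C_infinityD: "C_infinity f \<Longrightarrow> foldr partial_deriv is f differentiable at x"
  by (simp add: C_infinity_def)

lemma C_infinity_foldr: "C_infinity f \<Longrightarrow> C_infinity (foldr partial_deriv is f)"
  unfolding C_infinity_def by (metis foldr_append o_apply)

lemma C_infinity_has_derivative:
  "C_infinity f \<Longrightarrow> (f has_derivative frechet_derivative f (at x)) (at x)"
  using C_infinityD[of f "[]"] by (simp add: frechet_derivative_works)

lemma partial_deriv_commute:
  assumes "C_infinity f"
  shows "partial_deriv i (partial_deriv j f) = partial_deriv j (partial_deriv i f)"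
proof
  fix x
  have "(partial_deriv k f has_derivative frechet_derivative (partial_deriv k f) (at x)) (at x)" for k
    using C_infinityD[OF assms, of "[k]"] by (simp add: frechet_derivative_works)
  from symmetric_second_derivative[OF C_infinity_has_derivative[OF assms]
    this[of j, unfolded partial_deriv_def[abs_def]] this[of i, unfolded partial_deriv_def[abs_def]]]
  show "partial_deriv i (partial_deriv j f) x = partial_deriv j (partial_deriv i f) x"
    by (simp add: partial_deriv_def[abs_def])
qed

text \<open>Repeated use of \<open>partial_deriv_commute\<close>; this brings a new derivative to
  its place in the enumeration \<open>coords\<close>.\<close>

lemma foldr_partial_deriv_move:
  assumes "C_infinity f"
  shows "foldr partial_deriv (i # xs @ ys) f = foldr partial_deriv (xs @ i # ys) f"
proof (induction xs)
  case (Cons j xs)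
  have "partial_deriv i (partial_deriv j (foldr partial_deriv (xs @ ys) f))
    = partial_deriv j (partial_deriv i (foldr partial_deriv (xs @ ys) f))"
    by (intro partial_deriv_commute C_infinity_foldr assms)
  then show ?case using Cons.IH by simp
qed simp

lemma distinct_coords: "distinct (coords :: 'd::finite list)" "set (coords :: 'd list) = UNIV"
proof -
  obtain js :: "'d list" where "set js = UNIV" "distinct js"
    using finite_distinct_list[of "UNIV :: 'd set"] by auto
  then have "distinct (coords :: 'd list) \<and> set (coords :: 'd list) = UNIV"
    unfolding coords_def by (intro someI_ex[of "\<lambda>js :: 'd list. distinct js \<and> set js = UNIV"]) blast
  then show "distinct (coords :: 'd list)" "set (coords :: 'd list) = UNIV" by auto
qed

text \<open>The word of directions that \<open>multi_deriv \<beta>\<close> applies, which makes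
  facts about lists of partial derivatives available for multi-indices.\<close>

definition mi_list :: "('d \<Rightarrow> nat) \<Rightarrow> 'd list \<Rightarrow> 'd list" where
  "mi_list \<beta> is = concat (map (\<lambda>i. replicate (\<beta> i) i) is)"

lemma multi_deriv_foldr: "multi_deriv \<beta> f = foldr partial_deriv (mi_list \<beta> coords) f"
proof -
  have r: "foldr partial_deriv (replicate n i) g = (partial_deriv i ^^ n) g" for n i and g :: "real ^ 'a \<Rightarrow> complex"
    by (induction n) auto
  have "foldr (\<lambda>i. partial_deriv i ^^ \<beta> i) is f = foldr partial_deriv (mi_list \<beta> is) f" for "is"
    by (induction "is") (auto simp: mi_list_def r)
  then show ?thesis by (simp add: multi_deriv_def)
qed

lemma C_infinity_multi_deriv: "C_infinity f \<Longrightarrow> C_infinity (multi_deriv \<beta> f)"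
  unfolding multi_deriv_foldr by (rule C_infinity_foldr)

lemma multi_deriv_0 [simp]: "multi_deriv (\<lambda>_. 0) f = f"
proof -
  have "foldr (\<lambda>i. partial_deriv i ^^ 0) is f = f" for "is" by (induction "is") auto
  then show ?thesis by (simp add: multi_deriv_def)
qed

lemma partial_deriv_multi_deriv:
  fixes f :: "real ^ 'd::finite \<Rightarrow> complex"
  assumes "C_infinity f"
  shows "partial_deriv i (multi_deriv \<beta> f) = multi_deriv (\<beta>(i := Suc (\<beta> i))) f"
proof -
  \<comment> \<open>Splitting \<open>coords\<close> at its only occurrence of \<open>i\<close>
    isolates the block of \<open>i\<close>; the parts before and after are unaffected by raising
    \<open>\<beta> i\<close>.\<close>
  obtain as bs where c: "(coords :: 'd list) = as @ i # bs" using distinct_coords(2) split_list[of i] by fastforce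
  then have "i \<notin> set as" "i \<notin> set bs" using distinct_coords(1)[where 'd = 'd] by (simp_all add: c)
  then have "mi_list (\<beta>(i := Suc (\<beta> i))) as = mi_list \<beta> as" "mi_list (\<beta>(i := Suc (\<beta> i))) bs = mi_list \<beta> bs"
    by (auto simp: mi_list_def intro!: arg_cong[of _ _ concat])
  then have "mi_list (\<beta>(i := Suc (\<beta> i))) coords = mi_list \<beta> as @ i # replicate (\<beta> i) i @ mi_list \<beta> bs"
    "mi_list \<beta> coords = mi_list \<beta> as @ replicate (\<beta> i) i @ mi_list \<beta> bs"
    unfolding c by (auto simp: mi_list_def)
  then show ?thesis
    unfolding multi_deriv_foldr
    using foldr_partial_deriv_move[OF assms, of i "mi_list \<beta> as" "replicate (\<beta> i) i @ mi_list \<beta> bs"]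
    by simp
qed

section \<open>Linearity of iterated derivatives\<close>

lemma partial_deriv_add:
  assumes "\<And>x. f differentiable at x" "\<And>x. g differentiable at x"
  shows "partial_deriv i (f + g) = partial_deriv i f + partial_deriv i g"
proof
  fix x
  have "(f + g has_derivative (\<lambda>h. frechet_derivative f (at x) h + frechet_derivative g (at x) h)) (at x)"
    unfolding plus_fun_def using assms by (intro has_derivative_add) (simp_all add: frechet_derivative_works[symmetric])
  from frechet_derivative_at[OF this]
  show "partial_deriv i (f + g) x = (partial_deriv i f + partial_deriv i g) x"
    by (simp add: partial_deriv_def fun_eq_iff)
qed

lemma partial_deriv_smul:
  assumes "\<And>x. f differentiable at x"
  shows "partial_deriv i (fun_smul c f) = fun_smul c (partial_deriv i f)"
proof
  fix x
  have "(fun_smul c f has_derivative (\<lambda>h. c * frechet_derivative f (at x) h)) (at x)"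
    unfolding fun_smul_def using assms by (intro has_derivative_mult_right) (simp add: frechet_derivative_works[symmetric])
  from frechet_derivative_at[OF this]
  show "partial_deriv i (fun_smul c f) x = fun_smul c (partial_deriv i f) x"
    by (simp add: partial_deriv_def fun_smul_def fun_eq_iff)
qed

lemma foldr_partial_deriv_add:
  assumes "C_infinity f" "C_infinity g"
  shows "foldr partial_deriv is (f + g) = foldr partial_deriv is f + foldr partial_deriv is g"
  using assms by (induction "is") (simp_all add: partial_deriv_add C_infinityD)

lemma foldr_partial_deriv_smul:
  assumes "C_infinity f"
  shows "foldr partial_deriv is (fun_smul c f) = fun_smul c (foldr partial_deriv is f)"
  using assms by (induction "is") (simp_all add: partial_deriv_smul C_infinityD)

lemma C_infinity_add:
  assumes "C_infinity f" "C_infinity g"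
  shows "C_infinity (f + g)"
  unfolding C_infinity_def foldr_partial_deriv_add[OF assms]
  using assms by (auto simp: plus_fun_def C_infinityD intro!: differentiable_add)

lemma C_infinity_smul:
  assumes "C_infinity f"
  shows "C_infinity (fun_smul c f)"
  unfolding C_infinity_def foldr_partial_deriv_smul[OF assms]
  using assms by (auto simp: fun_smul_def C_infinityD intro!: differentiable_mult)

lemma C_infinity_0: "C_infinity 0"
proof -
  have "partial_deriv i (\<lambda>_. 0) = (\<lambda>_. 0)" for i :: 'a
    by (simp add: partial_deriv_def[abs_def])
  then have "foldr partial_deriv is (\<lambda>_. 0) = (\<lambda>_. 0)" for "is" :: "'a list" by (induction "is") auto
  then show ?thesis by (simp add: C_infinity_def zero_fun_def)
qed

section \<open>Mean value estimates from a point of high-order vanishing\<close>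

lemma frechet_derivative_le:
  fixes g :: "real ^ 'd::finite \<Rightarrow> complex"
  assumes "g differentiable at x" "\<And>i. norm (partial_deriv i g x) \<le> B"
  shows "norm (frechet_derivative g (at x) h) \<le> real CARD('d) * B * norm h"
proof -
  interpret linear "frechet_derivative g (at x)"
    using assms(1) by (rule linear_frechet_derivative)
  have "frechet_derivative g (at x) h = frechet_derivative g (at x) (\<Sum>i\<in>UNIV. vec_nth h i *\<^sub>R axis i 1)"
    by (simp add: basis_expansion scalar_mult_eq_scaleR[symmetric])
  also have "\<dots> = (\<Sum>i\<in>UNIV. vec_nth h i *\<^sub>R partial_deriv i g x)"
    by (simp add: sum scale partial_deriv_def)
  also have "norm \<dots> \<le> (\<Sum>i\<in>(UNIV::'d set). norm h * B)"
    by (rule sum_norm_le) (auto intro!: mult_mono component_le_norm_cart assms)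
  finally show ?thesis by (simp add: ac_simps)
qed

lemma mi_abs_add: "mi_abs (\<alpha> + \<beta>) = mi_abs \<alpha> + mi_abs \<beta>"
  by (simp add: mi_abs_def sum.distrib)

text \<open>Induction on \<open>L\<close>: the first partial derivatives satisfy the hypotheses with
  \<open>L\<close> lowered by one, and the mean value theorem started at the zero \<open>y\<close>
  gains the factor \<open>\<rho>\<close> at the cost of \<open>CARD('d)\<close>. The bound is stated
  for every point \<open>z\<close> of the segment because the mean value theorem needs the
  derivatives bounded along all of it.\<close>

lemma iterated_mean_value:
  fixes f :: "real ^ 'd::finite \<Rightarrow> complex"
  assumes f: "C_infinity f" and xy: "norm (x - y) \<le> \<rho>" and "z \<in> closed_segment x y"
    and "\<And>\<gamma>. mi_abs \<gamma> < L \<Longrightarrow> multi_deriv (\<beta> + \<gamma>) f y = 0"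
    and "\<And>\<gamma> w. mi_abs \<gamma> = L \<Longrightarrow> w \<in> closed_segment x y \<Longrightarrow> norm (multi_deriv (\<beta> + \<gamma>) f w) \<le> B"
  shows "norm (multi_deriv \<beta> f z) \<le> (real CARD('d) * \<rho>) ^ L * B"
  using assms(3-5)
proof (induction L arbitrary: \<beta> z)
  case 0
  show ?case using "0.prems"(3)[of "\<lambda>_. 0" z] "0.prems"(1) by (simp add: mi_abs_def plus_fun_def)
next
  case (Suc L)
  define B' where "B' = (real CARD('d) * \<rho>) ^ L * B"
  have step: "norm (partial_deriv i (multi_deriv \<beta> f) w) \<le> B'" if w: "w \<in> closed_segment x y" for i w
  proof -
    define \<epsilon> where "\<epsilon> = (\<lambda>k. if k = i then 1 else 0 :: nat)"
    have eq: "\<beta>(i := Suc (\<beta> i)) = \<beta> + \<epsilon>" by (auto simp: \<epsilon>_def)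
    have \<epsilon>: "mi_abs \<epsilon> = 1" by (simp add: mi_abs_def \<epsilon>_def)
    show ?thesis
      unfolding partial_deriv_multi_deriv[OF f] eq B'_def
    proof (rule Suc.IH[OF w])
      have Suc_abs: "mi_abs (\<epsilon> + \<gamma>) = Suc (mi_abs \<gamma>)" for \<gamma>
        using \<epsilon> by (simp add: mi_abs_add)
      show "multi_deriv (\<beta> + \<epsilon> + \<gamma>) f y = 0" if "mi_abs \<gamma> < L" for \<gamma>
        unfolding add.assoc by (rule Suc.prems(2)) (use that Suc_abs in \<open>simp add: plus_fun_def\<close>)
      show "norm (multi_deriv (\<beta> + \<epsilon> + \<gamma>) f w) \<le> B" if "mi_abs \<gamma> = L" "w \<in> closed_segment x y" for \<gamma> w
        unfolding add.assoc by (rule Suc.prems(3)) (use that Suc_abs in \<open>simp_all add: plus_fun_def\<close>)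
    qed
  qed
  let ?g = "multi_deriv \<beta> f"
  have B': "0 \<le> B'" using step[OF Suc.prems(1)] norm_ge_zero order_trans by blast
  have der: "(?g has_derivative frechet_derivative ?g (at w)) (at w within closed_segment x y)" for w
    using C_infinity_has_derivative[OF C_infinity_multi_deriv[OF f]] by (rule has_derivative_at_withinI)
  have diff: "?g differentiable at w" for w
    using C_infinityD[OF C_infinity_multi_deriv[OF f], of "[]"] by simp
  have "norm (?g z - ?g y) \<le> (real CARD('d) * B') * norm (z - y)"
    by (rule differentiable_bound[OF _ der])
      (use Suc.prems(1) in \<open>auto intro!: onorm_le frechet_derivative_le diff step\<close>)
  also have "norm (z - y) \<le> \<rho>"
    using segment_bound(2)[OF Suc.prems(1)] xy by (simp add: norm_minus_commute)
  finally have "norm (?g z - ?g y) \<le> (real CARD('d) * B') * \<rho>" using B' by (simp add: mult_left_mono)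
  moreover have "?g y = 0" using Suc.prems(2)[of "\<lambda>_. 0"] by (simp add: mi_abs_def plus_fun_def)
  ultimately show ?case by (simp add: B'_def ac_simps)
qed


section \<open>The seminorms of the space\<close>

lemma vector_space_fun_smul: "vector_space fun_smul"
  by unfold_locales (auto simp: fun_smul_def fun_eq_iff algebra_simps)

lemma multi_deriv_add:
  "C_infinity f \<Longrightarrow> C_infinity g \<Longrightarrow> multi_deriv \<beta> (f + g) x = multi_deriv \<beta> f x + multi_deriv \<beta> g x"
  by (simp add: multi_deriv_foldr foldr_partial_deriv_add)

lemma multi_deriv_smul: "C_infinity f \<Longrightarrow> multi_deriv \<beta> (fun_smul c f) x = c * multi_deriv \<beta> f x"
  by (simp add: multi_deriv_foldr foldr_partial_deriv_smul) (simp add: fun_smul_def)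

text \<open>The factor \<open>(- \<i>) ^ mi_abs \<beta>\<close> of \<open>D_deriv\<close> has
  modulus one, so only the plain derivative remains.\<close>

lemma S_weight_eq:
  "S_weight M j f (\<alpha>, \<beta>, x) = \<bar>mi_monomial \<alpha> x\<bar> * norm (multi_deriv \<beta> f x) *
    (real j ^ (mi_abs \<alpha> + mi_abs \<beta>) / M (mi_abs \<alpha> + mi_abs \<beta>))"
  by (simp add: S_weight_def D_deriv_def norm_mult norm_power mi_abs_add[unfolded plus_fun_def])

lemma S_weight_add:
  assumes "\<And>p. 0 < M p" "C_infinity f" "C_infinity g"
  shows "S_weight M j (f + g) t \<le> S_weight M j f t + S_weight M j g t"
proof (cases t)
  case (fields \<alpha> \<beta> x)
  show ?thesis
    unfolding fields S_weight_eq distrib_right[symmetric] distrib_left[symmetric] multi_deriv_add[OF assms(2,3)]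
    by (intro mult_right_mono mult_left_mono norm_triangle_ineq) (auto simp: less_imp_le[OF assms(1)] intro!: divide_nonneg_nonneg)
qed

lemma S_weight_smul: "C_infinity f \<Longrightarrow> S_weight M j (fun_smul c f) t = norm c * S_weight M j f t"
  by (cases t) (simp add: S_weight_eq multi_deriv_smul norm_mult)

context
  fixes M :: "nat \<Rightarrow> real"
  assumes M: "\<And>p. 0 < M p"
begin

lemma S_weight_nonneg: "0 \<le> S_weight M j f t"
  by (cases t) (auto simp: S_weight_eq intro!: mult_nonneg_nonneg divide_nonneg_nonneg less_imp_le[OF M])

lemma S_spaceD:
  assumes "f \<in> S_space M"
  shows "C_infinity f" and "1 \<le> j \<Longrightarrow> bdd_above (range (S_weight M j f))"
  using assms by (auto simp: S_space_def)

lemma S_weight_le_seminorm: "f \<in> S_space M \<Longrightarrow> 1 \<le> j \<Longrightarrow> S_weight M j f t \<le> S_seminorm M j f"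
  unfolding S_seminorm_def by (intro cSUP_upper S_spaceD) auto

lemma S_seminorm_leI: "(\<And>t. S_weight M j f t \<le> B) \<Longrightarrow> S_seminorm M j f \<le> B"
  unfolding S_seminorm_def by (intro cSUP_least) auto

lemma S_seminorm_nonneg:
  assumes "f \<in> S_space M" "1 \<le> j"
  shows "0 \<le> S_seminorm M j f"
  using S_weight_nonneg S_weight_le_seminorm[OF assms] by (rule order_trans)

lemma subspace_S_space: "module.subspace fun_smul (S_space M :: (real ^ 'd::finite \<Rightarrow> complex) set)"
proof -
  interpret vector_space "fun_smul :: complex \<Rightarrow> (real ^ 'd \<Rightarrow> complex) \<Rightarrow> _" by (rule vector_space_fun_smul)
  show ?thesis
    unfolding subspace_def
  proof (intro conjI ballI allI)
    have "S_weight M j 0 t = 0" for j and t :: "('d \<Rightarrow> nat) \<times> ('d \<Rightarrow> nat) \<times> (real ^ 'd)"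
      using S_weight_smul[OF C_infinity_0, of M j 0 t] by (simp add: fun_smul_def zero_fun_def)
    then show "0 \<in> (S_space M :: (real ^ 'd \<Rightarrow> complex) set)" by (auto simp: S_space_def C_infinity_0)
  next
    fix f g :: "real ^ 'd \<Rightarrow> complex" assume fg: "f \<in> S_space M" "g \<in> S_space M"
    have "S_weight M j (f + g) t \<le> S_seminorm M j f + S_seminorm M j g" if "1 \<le> j" for j t
      by (rule order_trans[OF S_weight_add[OF M S_spaceD(1)[OF fg(1)] S_spaceD(1)[OF fg(2)]]])
        (intro add_mono S_weight_le_seminorm fg that)
    then show "f + g \<in> S_space M"
      using fg by (auto simp: S_space_def intro!: C_infinity_add bdd_aboveI2)
  next
    fix f :: "real ^ 'd \<Rightarrow> complex" and c assume f: "f \<in> S_space M"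
    have "S_weight M j (fun_smul c f) t \<le> norm c * S_seminorm M j f" if "1 \<le> j" for j t
      unfolding S_weight_smul[OF S_spaceD(1)[OF f]]
      by (intro mult_left_mono S_weight_le_seminorm f that) auto
    then show "fun_smul c f \<in> S_space M"
      using f by (auto simp: S_space_def intro!: C_infinity_smul bdd_aboveI2)
  qed
qed

lemma seminorm_on_S_seminorm:
  assumes "1 \<le> j"
  shows "seminorm_on fun_smul (S_space M :: (real ^ 'd::finite \<Rightarrow> complex) set) (S_seminorm M j)"
  unfolding seminorm_on_def
proof (intro conjI ballI allI)
  fix f g :: "real ^ 'd \<Rightarrow> complex" assume fg: "f \<in> S_space M" "g \<in> S_space M"
  show "S_seminorm M j (f + g) \<le> S_seminorm M j f + S_seminorm M j g"
    by (rule S_seminorm_leI, rule order_trans[OF S_weight_add[OF M S_spaceD(1)[OF fg(1)] S_spaceD(1)[OF fg(2)]]])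
      (intro add_mono S_weight_le_seminorm fg assms)
next
  interpret vector_space "fun_smul :: complex \<Rightarrow> (real ^ 'd \<Rightarrow> complex) \<Rightarrow> _" by (rule vector_space_fun_smul)
  fix f :: "real ^ 'd \<Rightarrow> complex" and c :: complex assume f: "f \<in> S_space M"
  \<comment> \<open>One inequality for all scalars suffices: applied to \<open>1 / c\<close> and
    \<open>fun_smul c f\<close> it gives the reverse inequality.\<close>
  have le: "S_seminorm M j (fun_smul b g) \<le> norm b * S_seminorm M j g" if "g \<in> S_space M" for b and g :: "real ^ 'd \<Rightarrow> complex"
    by (rule S_seminorm_leI) (auto simp: S_weight_smul S_spaceD[OF that] intro!: mult_left_mono S_weight_le_seminorm that assms)
  show "S_seminorm M j (fun_smul c f) = norm c * S_seminorm M j f"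
  proof (cases "c = 0")
    case True
    have "fun_smul c f \<in> S_space M" by (rule subspace_scale[OF subspace_S_space f])
    then show ?thesis using le[OF f, of c] True S_seminorm_nonneg assms by (metis antisym mult_zero_left norm_zero)
  next
    case False
    have "S_seminorm M j f = S_seminorm M j (fun_smul (1 / c) (fun_smul c f))" using False by simp
    also have "\<dots> \<le> norm (1 / c) * S_seminorm M j (fun_smul c f)"
      by (rule le) (rule subspace_scale[OF subspace_S_space f])
    finally have "norm c * S_seminorm M j f \<le> S_seminorm M j (fun_smul c f)"
      using False by (simp add: norm_divide field_simps)
    then show ?thesis using le[OF f, of c] by simp
  qed
qed (rule S_seminorm_nonneg[OF _ assms])

text \<open>The weights increase with \<open>j\<close>. This makes the family of seminorms directed,
  as the description of the continuous seminorms requires.\<close>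

lemma S_seminorm_mono:
  assumes "f \<in> S_space M" "1 \<le> j" "j \<le> j'"
  shows "S_seminorm M j f \<le> S_seminorm M j' f"
proof (rule S_seminorm_leI)
  fix t
  have "S_weight M j f t \<le> S_weight M j' f t"
  proof (cases t)
    case (fields \<alpha> \<beta> x)
    show ?thesis unfolding fields S_weight_eq
      by (intro mult_left_mono divide_right_mono power_mono mult_nonneg_nonneg)
        (use assms in \<open>auto intro: less_imp_le[OF M]\<close>)
  qed
  also have "\<dots> \<le> S_seminorm M j' f" by (intro S_weight_le_seminorm assms order_trans[OF assms(2,3)])
  finally show "S_weight M j f t \<le> S_seminorm M j' f" .
qed

lemma locally_convex_S_topology:
  "locally_convex_space fun_smul (S_topology M :: (real ^ 'd::finite \<Rightarrow> complex) topology)"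
proof -
  let ?E = "S_space M :: (real ^ 'd \<Rightarrow> complex) set" and ?P = "{S_seminorm M j | j. 1 \<le> j} :: ((real ^ 'd \<Rightarrow> complex) \<Rightarrow> real) set"
  have P: "seminorm_on fun_smul ?E p" if "p \<in> ?P" for p
    using that seminorm_on_S_seminorm by blast
  have "\<exists>p\<in>?P. p f \<noteq> 0" if f: "f \<in> ?E" "f \<noteq> 0" for f
  proof -
    \<comment> \<open>The weight with both multi-indices zero is \<open>norm (f x) / M 0\<close>, so
      the first seminorm already separates points.\<close>
    obtain x where "f x \<noteq> 0" using f(2) by (auto simp: fun_eq_iff)
    then have "0 < S_weight M 1 f (\<lambda>_. 0, \<lambda>_. 0, x)" by (simp add: S_weight_eq mi_monomial_def mi_abs_def M)
    also have "\<dots> \<le> S_seminorm M 1 f" by (rule S_weight_le_seminorm[OF f(1)]) simp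
    finally show ?thesis by (intro bexI[of _ "S_seminorm M 1"]) auto
  qed
  then have "Hausdorff_space (seminorm_topology ?E ?P)"
    using Hausdorff_seminorm_topology[OF vector_space_fun_smul subspace_S_space P] by blast
  then show ?thesis
    unfolding locally_convex_space_def S_topology_def topspace_seminorm_topology
    using vector_space_fun_smul subspace_S_space P by blast
qed

lemma continuous_seminorm_S_topology:
  fixes p :: "(real ^ 'd::finite \<Rightarrow> complex) \<Rightarrow> real"
  assumes "continuous_seminorm fun_smul (S_topology M) p"
  obtains j C where "1 \<le> j" "0 < C" "\<And>f. f \<in> S_space M \<Longrightarrow> p f \<le> C * S_seminorm M j f"
proof -
  let ?P = "{S_seminorm M j | j. 1 \<le> j} :: ((real ^ 'd \<Rightarrow> complex) \<Rightarrow> real) set"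
  have "\<exists>r\<in>?P. \<exists>C>0. \<forall>f\<in>S_space M. p f \<le> C * r f"
  proof (rule continuous_seminorm_bound[OF vector_space_fun_smul subspace_S_space])
    show "\<exists>r\<in>?P. \<forall>f\<in>S_space M. p f \<le> r f \<and> p' f \<le> r f" if p: "p \<in> ?P" and p': "p' \<in> ?P" for p p'
    proof -
      obtain i j where ij: "p = S_seminorm M i" "1 \<le> i" "p' = S_seminorm M j" "1 \<le> j" using p p' by blast
      then show ?thesis
        by (intro bexI[of _ "S_seminorm M (max i j)"]) (auto intro!: S_seminorm_mono exI[of _ "max i j"])
    qed
  qed (use assms seminorm_on_S_seminorm in \<open>auto simp: S_topology_def\<close>)
  then show ?thesis using that by blast
qed

section \<open>Bounds on single derivatives and iteration of condition \<open>(M2)'\<close>\<close>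

lemma multi_deriv_le:
  assumes "f \<in> S_space M" "1 \<le> j"
  shows "\<bar>mi_monomial \<alpha> x\<bar> * norm (multi_deriv \<beta> f x)
    \<le> S_seminorm M j f * (M (mi_abs \<alpha> + mi_abs \<beta>) / real j ^ (mi_abs \<alpha> + mi_abs \<beta>))"
proof -
  have "S_weight M j f (\<alpha>, \<beta>, x) \<le> S_seminorm M j f" by (rule S_weight_le_seminorm[OF assms])
  then show ?thesis using assms(2) M unfolding S_weight_eq by (simp add: field_simps)
qed

text \<open>Taking the monomial of degree zero in the seminorm bounds the point evaluations of
  derivatives. The factor \<open>C\<close> fits the seminorm \<open>q\<close> of the final proof,
  which is a multiple of some \<open>S_seminorm\<close>.\<close>

lemma bounded_functional_multi_deriv:
  assumes "1 \<le> j" "0 < C"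
  shows "bounded_functional fun_smul (S_space M :: (real ^ 'd::finite \<Rightarrow> complex) set) (\<lambda>f. C * S_seminorm M j f)
    (\<lambda>f. multi_deriv \<beta> f y)"
  unfolding bounded_functional_def complex_linear_on_def
proof (intro conjI ballI allI exI)
  fix f :: "real ^ 'd \<Rightarrow> complex" assume f: "f \<in> S_space M"
  show "norm (multi_deriv \<beta> f y) \<le> (M (mi_abs \<beta>) / real j ^ mi_abs \<beta> / C) * (C * S_seminorm M j f)"
    using multi_deriv_le[OF f assms(1), of "\<lambda>_. 0" y \<beta>] assms(2) by (simp add: mi_monomial_def mi_abs_def ac_simps)
qed (auto simp: multi_deriv_add multi_deriv_smul S_spaceD)

text \<open>Condition \<open>(M2)'\<close> is iterated \<open>L\<close> times; since
  \<open>H ^ (p + L)\<close> splits as \<open>H ^ p * H ^ L\<close>, each step contributes one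
  factor \<open>H ^ p\<close> and a constant. The maximum with \<open>1\<close> in the induction
  keeps the constant at least one.\<close>

lemma M_add_le:
  assumes "\<And>p. M (p + 1) \<le> A * H ^ p * M p" "0 < A" "0 < H"
  shows "\<exists>C\<ge>1. \<forall>p. M (p + L) \<le> C * (H ^ L) ^ p * M p"
proof (induction L)
  case (Suc L)
  then obtain C where C: "1 \<le> C" "\<And>p. M (p + L) \<le> C * (H ^ L) ^ p * M p" by blast
  have "M (p + Suc L) \<le> max 1 (A * H ^ L * C) * (H ^ Suc L) ^ p * M p" for p
  proof -
    have "M (p + Suc L) \<le> A * H ^ (p + L) * M (p + L)" using assms(1)[of "p + L"] by simp
    also have "\<dots> \<le> A * H ^ (p + L) * (C * (H ^ L) ^ p * M p)"
      using assms by (intro mult_left_mono C) auto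
    also have "\<dots> = (A * H ^ L * C) * ((H ^ Suc L) ^ p * M p)"
      by (simp add: power_add power_mult_distrib)
    also have "\<dots> \<le> max 1 (A * H ^ L * C) * ((H ^ Suc L) ^ p * M p)"
      using assms less_imp_le[OF M] by (intro mult_right_mono mult_nonneg_nonneg) auto
    finally show ?thesis by (simp add: mult.assoc)
  qed
  then show ?case by (intro exI[of _ "max 1 (A * H ^ L * C)"]) auto
qed (auto intro!: exI[of _ 1])

end


section \<open>Sampling on dyadic grids\<close>

text \<open>Numerators up to \<open>4 ^ k\<close> over the denominator \<open>2 ^ k\<close> fill the
  cube of radius \<open>2 ^ k\<close>. The encoding by integer vectors turns counting and rounding
  into questions about integers.\<close>

definition dyadic_grid :: "nat \<Rightarrow> (real ^ 'd::finite) set" where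
  "dyadic_grid k = (\<lambda>m. \<chi> i. real_of_int (m i) / 2 ^ k) ` {m. \<forall>i. \<bar>m i\<bar> \<le> 4 ^ k}"

lemma dyadic_grid_mono: "dyadic_grid k \<subseteq> dyadic_grid (Suc k)"
proof
  fix y :: "real ^ 'd" assume "y \<in> dyadic_grid k"
  then obtain m where m: "y = (\<chi> i. real_of_int (m i) / 2 ^ k)" "\<forall>i. \<bar>m i\<bar> \<le> 4 ^ k"
    by (auto simp: dyadic_grid_def)
  have "\<bar>2 * m i\<bar> \<le> 4 ^ Suc k" for i using m(2)[rule_format, of i] by (simp add: abs_mult)
  moreover have "y = (\<chi> i. real_of_int (2 * m i) / 2 ^ Suc k)" by (simp add: m(1))
  ultimately show "y \<in> dyadic_grid (Suc k)"
    unfolding dyadic_grid_def by (intro image_eqI[of _ _ "\<lambda>i. 2 * m i"]) auto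
qed

lemma finite_fun_set:
  assumes "finite B"
  shows "finite {m :: 'd::finite \<Rightarrow> 'b. \<forall>i. m i \<in> B}"
    and "card {m :: 'd::finite \<Rightarrow> 'b. \<forall>i. m i \<in> B} = card B ^ CARD('d)"
proof -
  have "{m :: 'd \<Rightarrow> 'b. \<forall>i. m i \<in> B} = (\<Pi>\<^sub>E i\<in>UNIV. B)" by auto
  then show "finite {m :: 'd \<Rightarrow> 'b. \<forall>i. m i \<in> B}" "card {m :: 'd \<Rightarrow> 'b. \<forall>i. m i \<in> B} = card B ^ CARD('d)"
    using assms by (simp_all add: finite_PiE card_PiE)
qed

text \<open>Each coordinate takes at most \<open>2 * 4 ^ k + 1\<close> values, which is at most
  \<open>3 * 4 ^ k\<close>.\<close>

lemma card_dyadic_grid: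
  "finite (dyadic_grid k :: (real ^ 'd::finite) set)"
  "card (dyadic_grid k :: (real ^ 'd::finite) set) \<le> (3 * 4 ^ k) ^ CARD('d)"
proof -
  have eq: "{m :: 'd \<Rightarrow> int. \<forall>i. \<bar>m i\<bar> \<le> 4 ^ k} = {m. \<forall>i. m i \<in> {-(4 ^ k)..4 ^ k}}"
    by (simp add: abs_le_iff minus_le_iff[of "4 ^ k"] conj_commute)
  show "finite (dyadic_grid k :: (real ^ 'd::finite) set)"
    unfolding dyadic_grid_def eq by (intro finite_imageI finite_fun_set) simp
  have "card (dyadic_grid k :: (real ^ 'd::finite) set) \<le> card {-(4 ^ k)..4 ^ k :: int} ^ CARD('d)"
    unfolding dyadic_grid_def eq finite_fun_set(2)[OF finite_atLeastAtMost_int, symmetric]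
    by (intro card_image_le finite_fun_set) simp
  also have "card {-(4 ^ k)..4 ^ k :: int} \<le> 3 * 4 ^ k"
  proof -
    have "(1::int) \<le> 4 ^ k" by simp
    then have "int (card {-(4 ^ k)..4 ^ k :: int}) \<le> int (3 * 4 ^ k)" by simp
    then show ?thesis by linarith
  qed
  finally show "card (dyadic_grid k :: (real ^ 'd::finite) set) \<le> (3 * 4 ^ k) ^ CARD('d)"
    by (simp add: power_mono)
qed

text \<open>
  Rounding away from the origin makes the monomials grow along the segment from \<open>x\<close> to the grid point.
\<close>

lemma dyadic_grid_outward:
  fixes x :: "real ^ 'd::finite"
  assumes x: "\<And>i. \<bar>vec_nth x i\<bar> \<le> 2 ^ k"
  obtains y where "y \<in> dyadic_grid k" "norm (x - y) \<le> real CARD('d) / 2 ^ k"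
    "\<And>z i. z \<in> closed_segment x y \<Longrightarrow> \<bar>vec_nth x i\<bar> \<le> \<bar>vec_nth z i\<bar>"
proof -
  define m where "m i = (if 0 \<le> vec_nth x i then \<lceil>vec_nth x i * 2 ^ k\<rceil> else \<lfloor>vec_nth x i * 2 ^ k\<rfloor>)" for i
  define y :: "real ^ 'd" where "y = (\<chi> i. real_of_int (m i) / 2 ^ k)"
  have yi: "vec_nth y i = real_of_int (m i) / 2 ^ k" for i by (simp add: y_def)
  \<comment> \<open>Rounding outward does not leave the cube, because the bound \<open>4 ^ k\<close>
    on the scaled coordinates is itself an integer.\<close>
  have m4: "\<bar>m i\<bar> \<le> 4 ^ k" for i
  proof -
    have "\<bar>vec_nth x i * 2 ^ k\<bar> \<le> 2 ^ k * 2 ^ k" using x[of i] by (simp add: abs_mult)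
    also have "(2::real) ^ k * 2 ^ k = 4 ^ k" by (simp flip: power_mult_distrib)
    finally have b: "vec_nth x i * 2 ^ k \<le> of_int (4 ^ k)" "of_int (- (4 ^ k)) \<le> vec_nth x i * 2 ^ k" by auto
    show ?thesis
    proof (cases "0 \<le> vec_nth x i")
      case True
      then have "0 \<le> vec_nth x i * 2 ^ k" by simp
      then have "0 \<le> \<lceil>vec_nth x i * 2 ^ k\<rceil>" by linarith
      then have "0 \<le> m i" using True by (simp add: m_def)
      moreover have "m i \<le> 4 ^ k" using b(1) True by (simp add: m_def ceiling_le_iff)
      ultimately show ?thesis by simp
    next
      case False
      then have "m i \<le> 0" by (simp add: m_def floor_le_iff mult_less_0_iff) (smt (verit) mult_neg_pos zero_less_power)
      moreover have "- (4 ^ k) \<le> m i" using b(2) False by (simp add: m_def le_floor_iff)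
      ultimately show ?thesis by simp
    qed
  qed
  have pos: "(0::real) < 2 ^ k" by simp
  have near: "\<bar>vec_nth x i - vec_nth y i\<bar> \<le> 1 / 2 ^ k" for i
  proof -
    have "\<bar>t - \<lceil>t\<rceil>\<bar> \<le> 1" "\<bar>t - \<lfloor>t\<rfloor>\<bar> \<le> 1" for t :: real by linarith+
    then have "\<bar>vec_nth x i * 2 ^ k - m i\<bar> \<le> 1" by (simp add: m_def)
    then have "\<bar>vec_nth x i * 2 ^ k - m i\<bar> / 2 ^ k \<le> 1 / 2 ^ k" by (rule divide_right_mono) simp
    also have "\<bar>vec_nth x i * 2 ^ k - m i\<bar> / 2 ^ k = \<bar>(vec_nth x i * 2 ^ k - m i) / 2 ^ k\<bar>" by simp
    finally show ?thesis by (simp add: yi diff_divide_distrib)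
  qed
  show ?thesis
  proof (rule that)
    show "y \<in> dyadic_grid k" unfolding dyadic_grid_def y_def using m4 by blast
    have "norm (x - y) \<le> (\<Sum>i\<in>UNIV. \<bar>vec_nth (x - y) i\<bar>)" by (rule norm_le_l1_cart)
    also have "\<dots> \<le> (\<Sum>i\<in>(UNIV::'d set). 1 / 2 ^ k)" using near by (intro sum_mono) simp
    finally show "norm (x - y) \<le> real CARD('d) / 2 ^ k" by simp
    fix z i assume "z \<in> closed_segment x y"
    then obtain t where t: "0 \<le> t" "t \<le> 1" "z = (1 - t) *\<^sub>R x + t *\<^sub>R y" by (auto simp: closed_segment_def)
    then have z: "vec_nth z i = vec_nth x i + t * (vec_nth y i - vec_nth x i)"
      by (simp only: t(3) vector_add_component vector_scaleR_component) (simp add: algebra_simps)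
    show "\<bar>vec_nth x i\<bar> \<le> \<bar>vec_nth z i\<bar>"
    proof (cases "0 \<le> vec_nth x i")
      case True
      then have "vec_nth x i * 2 ^ k \<le> m i" by (simp add: m_def)
      then have "vec_nth x i \<le> vec_nth y i" by (simp add: yi pos_le_divide_eq)
      then have "0 \<le> t * (vec_nth y i - vec_nth x i)" using t by simp
      then show ?thesis using True z by linarith
    next
      case False
      then have "m i \<le> vec_nth x i * 2 ^ k" by (simp add: m_def)
      then have "vec_nth y i \<le> vec_nth x i" by (simp add: yi pos_divide_le_eq)
      then have "t * (vec_nth y i - vec_nth x i) \<le> 0" using t by (simp add: mult_nonneg_nonpos)
      then show ?thesis using False z by linarith
    qed
  qed
qed

lemma abs_mi_monomial_mono:
  assumes "\<And>i. \<bar>vec_nth x i\<bar> \<le> \<bar>vec_nth z i\<bar>"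
  shows "\<bar>mi_monomial \<alpha> x\<bar> \<le> \<bar>mi_monomial \<alpha> z\<bar>"
  unfolding mi_monomial_def abs_prod power_abs using assms by (intro prod_mono) (auto intro: power_mono)

text \<open>For \<open>mi_abs \<beta> < k\<close> and \<open>mi_abs \<gamma> < L\<close> the sum
  \<open>\<beta> + \<gamma>\<close> has order below \<open>k + L\<close>, which is at most
  \<open>(L + 1) * k\<close> once \<open>k\<close> is positive. A multiple of \<open>k\<close> as
  the bound keeps the family increasing and makes it empty for \<open>k = 0\<close>, where the
  telescoping starts.\<close>

definition sampling_set :: "nat \<Rightarrow> nat \<Rightarrow> (('d::finite \<Rightarrow> nat) \<times> (real ^ 'd)) set" where
  "sampling_set L k = {\<beta>. mi_abs \<beta> < (L + 1) * k} \<times> dyadic_grid k"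

text \<open>There are at most \<open>((L + 1) * k) ^ CARD('d)\<close> multi-indices and
  \<open>(3 * 4 ^ k) ^ CARD('d)\<close> grid points; estimating \<open>k\<close> by
  \<open>2 ^ k\<close> makes the product geometric in \<open>k\<close>.\<close>

lemma sampling_set:
  "sampling_set L 0 = ({} :: (('d::finite \<Rightarrow> nat) \<times> (real ^ 'd)) set)"
  "(sampling_set L k :: (('d::finite \<Rightarrow> nat) \<times> (real ^ 'd)) set) \<subseteq> sampling_set L (Suc k)"
  "finite (sampling_set L k :: (('d::finite \<Rightarrow> nat) \<times> (real ^ 'd)) set)"
  "card (sampling_set L k :: (('d::finite \<Rightarrow> nat) \<times> (real ^ 'd)) set) \<le> ((L + 1) * 3) ^ CARD('d) * (8 ^ CARD('d)) ^ k"
proof -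
  show "sampling_set L 0 = ({} :: (('d::finite \<Rightarrow> nat) \<times> (real ^ 'd)) set)" by (simp add: sampling_set_def)
  show "(sampling_set L k :: (('d::finite \<Rightarrow> nat) \<times> (real ^ 'd)) set) \<subseteq> sampling_set L (Suc k)"
    unfolding sampling_set_def using dyadic_grid_mono by (intro Sigma_mono) auto
  have sub: "{\<beta> :: 'd \<Rightarrow> nat. mi_abs \<beta> < (L + 1) * k} \<subseteq> {\<beta>. \<forall>i. \<beta> i \<in> {..<(L + 1) * k}}"
  proof (intro subsetI CollectI allI)
    fix \<beta> :: "'d \<Rightarrow> nat" and i assume "\<beta> \<in> {\<beta>. mi_abs \<beta> < (L + 1) * k}"
    moreover have "\<beta> i \<le> mi_abs \<beta>" unfolding mi_abs_def by (intro member_le_sum) auto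
    ultimately show "\<beta> i \<in> {..<(L + 1) * k}" by simp
  qed
  note fin = finite_fun_set(1)[OF finite_lessThan] finite_fun_set(2)[OF finite_lessThan]
  show "finite (sampling_set L k :: (('d::finite \<Rightarrow> nat) \<times> (real ^ 'd)) set)"
    unfolding sampling_set_def by (intro finite_cartesian_product finite_subset[OF sub fin(1)] card_dyadic_grid)
  have "card {\<beta> :: 'd \<Rightarrow> nat. mi_abs \<beta> < (L + 1) * k} \<le> ((L + 1) * k) ^ CARD('d)"
    using card_mono[OF fin(1) sub] unfolding fin(2) card_lessThan .
  also have "\<dots> \<le> ((L + 1) * 2 ^ k) ^ CARD('d)" by (intro power_mono mult_left_mono) auto
  finally have "card (sampling_set L k :: (('d::finite \<Rightarrow> nat) \<times> (real ^ 'd)) set)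
      \<le> ((L + 1) * 2 ^ k) ^ CARD('d) * (3 * 4 ^ k) ^ CARD('d)"
    unfolding sampling_set_def card_cartesian_product by (intro mult_mono card_dyadic_grid) auto
  also have "\<dots> = (((L + 1) * 3) * (2 ^ k * 4 ^ k)) ^ CARD('d)"
    by (simp only: power_mult_distrib[symmetric] ac_simps)
  also have "(2::nat) ^ k * 4 ^ k = 8 ^ k" by (simp flip: power_mult_distrib)
  also have "(((L + 1) * 3) * 8 ^ k) ^ CARD('d) = ((L + 1) * 3) ^ CARD('d) * (8 ^ CARD('d)) ^ k"
    by (simp only: power_mult_distrib power_mult[symmetric] mult.commute)
  finally show "card (sampling_set L k :: (('d::finite \<Rightarrow> nat) \<times> (real ^ 'd)) set) \<le> ((L + 1) * 3) ^ CARD('d) * (8 ^ CARD('d)) ^ k" .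
qed

text \<open>The larger index \<open>j * h\<close> has two tasks: \<open>K \<le> real h\<close>
  absorbs the growth of \<open>M\<close> under a shift by \<open>L\<close>, and
  \<open>2 ^ L \<le> h\<close> gives the decay for orders at least \<open>k\<close>.\<close>

lemma S_seminorm_le_of_vanishing:
  fixes f :: "real ^ 'd::finite \<Rightarrow> complex"
  assumes M: "\<And>p. 0 < M p" and C: "1 \<le> C" "\<And>p. M (p + L) \<le> C * K ^ p * M p"
    and h: "K \<le> real h" "2 ^ L \<le> h" and j: "1 \<le> j" and f: "f \<in> S_space M"
    and van: "\<And>\<beta> y. (\<beta>, y) \<in> sampling_set L k \<Longrightarrow> multi_deriv \<beta> f y = 0"
  shows "S_seminorm M j f \<le> C * (real CARD('d) ^ 2) ^ L * (1 / 2 ^ L) ^ k * S_seminorm M (j * h) f"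
proof (rule S_seminorm_leI[OF M])
  fix t :: "('d \<Rightarrow> nat) \<times> ('d \<Rightarrow> nat) \<times> (real ^ 'd)"
  obtain \<alpha> \<beta> x where t: "t = (\<alpha>, \<beta>, x)" by (cases t)
  define s where "s = mi_abs \<alpha> + mi_abs \<beta>"
  define Q where "Q = S_seminorm M (j * h) f"
  \<comment> \<open>Of the two factors \<open>CARD('d)\<close>, one comes from the distance to the
    grid point and the other from the mean value theorem.\<close>
  define \<Delta> where "\<Delta> = (real CARD('d) ^ 2) ^ L"
  define e where "e = (1 / 2 ^ L :: real) ^ k"
  have e: "0 < e" "e = 1 / (2 ^ k) ^ L" by (simp_all add: e_def power_divide mult.commute flip: power_mult)
  have "1 \<le> h" using h(2) order_trans[OF one_le_power[of "2::nat" L]] by simp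
  then have jh: "1 \<le> j * h" and h0: "0 < real h" using j by auto
  have j0: "0 < real j" using j by simp
  have Q: "0 \<le> Q" unfolding Q_def by (rule S_seminorm_nonneg[OF M f jh])
  have \<Delta>: "1 \<le> \<Delta>" unfolding \<Delta>_def by (intro one_le_power) simp
  have K: "0 \<le> C * K ^ p" for p
    using order_trans[OF less_imp_le[OF M] C(2)[of p]] M[of p] by (simp add: zero_le_mult_iff)
  \<comment> \<open>Passing to order \<open>s + L\<close> costs \<open>C * K ^ s\<close>; the power
    \<open>real h ^ s\<close> contained in \<open>real (j * h) ^ (s + L)\<close> compensates for
    \<open>K ^ s\<close>.\<close>
  have shifted: "Q * (M (s + L) / real (j * h) ^ (s + L)) * (real j ^ s / M s) \<le> C * Q"
  proof -
    have "M (s + L) \<le> C * real h ^ s * M s"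
    proof (cases "0 \<le> K")
      case True
      then have "C * K ^ s * M s \<le> C * real h ^ s * M s"
        using h(1) C(1) less_imp_le[OF M] by (intro mult_right_mono mult_left_mono power_mono) auto
      then show ?thesis using C(2)[of s] by linarith
    next
      case False
      \<comment> \<open>A negative \<open>K\<close> is contradictory, since \<open>M\<close> is
        positive and \<open>1 \<le> C\<close>.\<close>
      have "0 \<le> C * K ^ 1" by (rule K)
      then show ?thesis using False C(1) by (simp add: zero_le_mult_iff)
    qed
    then have "M (s + L) / real (j * h) ^ (s + L) * (real j ^ s / M s)
        \<le> C * real h ^ s * M s / real (j * h) ^ (s + L) * (real j ^ s / M s)"
      using less_imp_le[OF M] by (intro mult_right_mono divide_right_mono) auto
    also have "\<dots> = C / real (j * h) ^ L"
      using M[of s] h0 j0 by (simp add: power_add power_mult_distrib field_simps)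
    also have "\<dots> \<le> C / 1"
      using jh(1) C(1)
      by (intro divide_left_mono one_le_power) (simp_all only: real_of_nat_ge_one_iff, auto)
    finally have "Q * (M (s + L) / real (j * h) ^ (s + L) * (real j ^ s / M s)) \<le> Q * C"
      using Q by (intro mult_left_mono) auto
    then show ?thesis by (simp add: ac_simps)
  qed
  have js: "0 \<le> real j ^ s / M s" using less_imp_le[OF M] by simp
  have W: "S_weight M j f t = \<bar>mi_monomial \<alpha> x\<bar> * norm (multi_deriv \<beta> f x) * (real j ^ s / M s)"
    unfolding t S_weight_eq s_def ..
  \<comment> \<open>The cases are high total order, a point with a large coordinate, and low order
    at a point of the cube, where the grid is used.\<close>
  consider "k \<le> s" | i where "2 ^ k < \<bar>vec_nth x i\<bar>" | "s < k" "\<And>i. \<bar>vec_nth x i\<bar> \<le> 2 ^ k"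
    by (meson not_le)
  then have "S_weight M j f t \<le> C * \<Delta> * e * Q"
  proof cases
    case 1
    have "S_weight M j f t \<le> Q * (M s / real (j * h) ^ s) * (real j ^ s / M s)"
      unfolding W using multi_deriv_le[OF M f jh, of \<alpha> x \<beta>] js
      by (intro mult_right_mono) (auto simp: s_def Q_def)
    also have "\<dots> = (1 / real h) ^ s * Q"
      using M[of s] h0 j0 by (simp add: power_mult_distrib field_simps)
    also have "\<dots> \<le> e * Q"
    proof (rule mult_right_mono[OF _ Q])
      \<comment> \<open>Each of the \<open>s \<ge> k\<close> orders contributes a factor
        \<open>1 / real h\<close>, which is at most \<open>1 / 2 ^ L\<close>.\<close>
      have "2 ^ L \<le> real h" using h(2) by (metis of_nat_le_iff of_nat_numeral of_nat_power)
      then have "(1 / real h) ^ s \<le> (1 / 2 ^ L) ^ s"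
        by (intro power_mono divide_left_mono mult_pos_pos h0) auto
      also have "\<dots> \<le> e" unfolding e_def using 1 by (intro power_decreasing) (auto simp: divide_le_eq)
      finally show "(1 / real h) ^ s \<le> e" .
    qed
    also have "\<dots> \<le> (C * \<Delta>) * (e * Q)"
      using mult_right_mono[of 1 "C * \<Delta>" "e * Q"] mult_mono[OF C(1) \<Delta>] C(1) e Q by simp
    finally show ?thesis by (simp add: ac_simps)
  next
    case 2
    \<comment> \<open>The monomial is raised by \<open>L\<close> powers of the large coordinate,
      which gains \<open>(2 ^ k) ^ L\<close> and moves the order to \<open>s + L\<close>.\<close>
    define \<gamma> where "\<gamma> = \<alpha>(i := \<alpha> i + L)"
    have \<gamma>: "mi_abs \<gamma> + mi_abs \<beta> = s + L"
    proof -
      have "mi_abs \<gamma> = mi_abs \<alpha> + L"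
        unfolding mi_abs_def \<gamma>_def by (simp add: sum.remove[of _ i])
      then show ?thesis by (simp add: s_def)
    qed
    have mon: "\<bar>mi_monomial \<gamma> x\<bar> = \<bar>mi_monomial \<alpha> x\<bar> * \<bar>vec_nth x i\<bar> ^ L"
      unfolding mi_monomial_def \<gamma>_def abs_prod power_abs
      by (simp add: prod.remove[of _ i] power_add)
    have "S_weight M j f t * (2 ^ k) ^ L \<le> S_weight M j f t * \<bar>vec_nth x i\<bar> ^ L"
      using 2 by (intro mult_left_mono power_mono S_weight_nonneg[OF M]) auto
    also have "\<dots> = \<bar>mi_monomial \<gamma> x\<bar> * norm (multi_deriv \<beta> f x) * (real j ^ s / M s)"
      unfolding W mon by (simp add: ac_simps)
    also have "\<dots> \<le> Q * (M (s + L) / real (j * h) ^ (s + L)) * (real j ^ s / M s)"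
      using multi_deriv_le[OF M f jh, of \<gamma> x \<beta>] js unfolding \<gamma> Q_def by (rule mult_right_mono)
    also have "\<dots> \<le> C * Q" by (rule shifted)
    finally have "S_weight M j f t \<le> e * (C * Q)" by (simp add: e(2) pos_le_divide_eq)
    also have "\<dots> \<le> \<Delta> * (e * (C * Q))"
      using mult_right_mono[OF \<Delta>, of "e * (C * Q)"] C(1) e Q by simp
    finally show ?thesis by (simp add: ac_simps)
  next
    case 3
    obtain y where y: "y \<in> dyadic_grid k" and xy: "norm (x - y) \<le> real CARD('d) / 2 ^ k"
      and out: "\<And>z i. z \<in> closed_segment x y \<Longrightarrow> \<bar>vec_nth x i\<bar> \<le> \<bar>vec_nth z i\<bar>"
      using dyadic_grid_outward[OF 3(2)] by blast
    show ?thesis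
    proof (cases "mi_monomial \<alpha> x = 0")
      case True
      then show ?thesis unfolding W using C(1) \<Delta> e Q by simp
    next
      case False
      \<comment> \<open>By the outward choice of \<open>y\<close> the monomial at any
        \<open>w\<close> on the segment is in absolute value at least that at \<open>x\<close>, so
        dividing by its value at \<open>x\<close> bounds the \<open>L\<close>-fold further
        derivatives along the whole segment.\<close>
      define B where "B = Q * (M (s + L) / real (j * h) ^ (s + L)) / \<bar>mi_monomial \<alpha> x\<bar>"
      have "norm (multi_deriv \<beta> f x) \<le> (real CARD('d) * (real CARD('d) / 2 ^ k)) ^ L * B"
      proof (rule iterated_mean_value[OF S_spaceD(1)[OF M f] xy])
        fix \<gamma> :: "'d \<Rightarrow> nat" assume "mi_abs \<gamma> < L"
        then have "mi_abs (\<beta> + \<gamma>) < k + L" using 3(1) by (simp add: mi_abs_add s_def)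
        also have "k + L \<le> (L + 1) * k" using 3(1) by (cases k) auto
        finally show "multi_deriv (\<beta> + \<gamma>) f y = 0"
          using y by (intro van) (simp add: sampling_set_def)
      next
        fix \<gamma> :: "'d \<Rightarrow> nat" and w assume \<gamma>: "mi_abs \<gamma> = L" and w: "w \<in> closed_segment x y"
        have "\<bar>mi_monomial \<alpha> x\<bar> * norm (multi_deriv (\<beta> + \<gamma>) f w)
            \<le> \<bar>mi_monomial \<alpha> w\<bar> * norm (multi_deriv (\<beta> + \<gamma>) f w)"
          using out[OF w] by (intro mult_right_mono abs_mi_monomial_mono) auto
        also have "\<dots> \<le> Q * (M (s + L) / real (j * h) ^ (s + L))"
          using multi_deriv_le[OF M f jh, of \<alpha> w "\<beta> + \<gamma>"]
          by (simp add: mi_abs_add \<gamma> s_def Q_def add.assoc)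
        finally show "norm (multi_deriv (\<beta> + \<gamma>) f w) \<le> B"
          unfolding B_def mult.commute[of "\<bar>mi_monomial \<alpha> x\<bar>"]
          by (subst pos_le_divide_eq) (use False in simp_all)
      qed simp
      also have "(real CARD('d) * (real CARD('d) / 2 ^ k)) ^ L = \<Delta> * e"
        by (simp add: \<Delta>_def e(2) power_divide power2_eq_square)
      finally have "\<bar>mi_monomial \<alpha> x\<bar> * norm (multi_deriv \<beta> f x)
          \<le> \<bar>mi_monomial \<alpha> x\<bar> * (\<Delta> * e * B)" by (rule mult_left_mono) simp
      also have "\<dots> = \<Delta> * e * (Q * (M (s + L) / real (j * h) ^ (s + L)))"
        using False by (simp add: B_def)
      finally have "S_weight M j f t \<le> \<Delta> * e * (Q * (M (s + L) / real (j * h) ^ (s + L))) * (real j ^ s / M s)"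
        unfolding W by (rule mult_right_mono[OF _ js])
      also have "\<dots> = \<Delta> * e * (Q * (M (s + L) / real (j * h) ^ (s + L)) * (real j ^ s / M s))"
        by (simp only: mult.assoc)
      also have "\<dots> \<le> \<Delta> * e * (C * Q)"
        using \<Delta> e by (intro mult_left_mono shifted) auto
      finally show ?thesis by (simp add: ac_simps)
    qed
  qed
  then show "S_weight M j f t \<le> C * (real CARD('d) ^ 2) ^ L * (1 / 2 ^ L) ^ k * S_seminorm M (j * h) f"
    by (simp add: \<Delta>_def e_def Q_def)
qed

section \<open>Choice of the parameters and assembly of the nuclear representation\<close>

theorem corollary2p3:
  fixes M :: "nat \<Rightarrow> real"
  assumes "\<And>p. 0 < M p"
    and "\<exists>A>0. \<exists>H>0. \<forall>p. M (p + 1) \<le> A * H ^ p * M p"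
    and "\<exists>H>0. \<forall>C>0. \<exists>B>0. \<forall>s p. sqrt (real s) ^ s * M p \<le> B * C ^ s * H ^ (s + p) * M (s + p)"
  shows "nuclear_space fun_smul (S_topology M :: (real ^ 'd::finite \<Rightarrow> complex) topology)"
  unfolding nuclear_space_def
proof (intro conjI allI impI)
  note M = assms(1)
  show "locally_convex_space fun_smul (S_topology M :: (real ^ 'd \<Rightarrow> complex) topology)"
    by (rule locally_convex_S_topology[OF M])
  fix p :: "(real ^ 'd \<Rightarrow> complex) \<Rightarrow> real"
  assume p: "continuous_seminorm fun_smul (S_topology M) p"
  let ?E = "S_space M :: (real ^ 'd \<Rightarrow> complex) set"
  obtain j D where j: "1 \<le> j" and D: "0 < D" "\<And>f. f \<in> ?E \<Longrightarrow> p f \<le> D * S_seminorm M j f"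
    using continuous_seminorm_S_topology[OF M p] by blast
  have top: "topspace (S_topology M) = ?E" by (simp add: S_topology_def)
  define d where "d = CARD('d)"
  \<comment> \<open>The product \<open>N k * N (Suc k)\<close> grows like
    \<open>64 ^ (d * k)\<close>, that is \<open>2 ^ (6 * d * k)\<close>, while
    \<open>\<epsilon> k\<close> decays like \<open>(1 / 2 ^ L) ^ k\<close>; the extra
    \<open>1\<close> leaves the convergent series of \<open>(1 / 2) ^ k\<close>.\<close>
  define L where "L = 6 * d + 1"
  obtain A H where AH: "0 < A" "0 < H" "\<And>p. M (p + 1) \<le> A * H ^ p * M p" using assms(2) by blast
  obtain C where C: "1 \<le> C" "\<And>p. M (p + L) \<le> C * (H ^ L) ^ p * M p"
    using M_add_le[OF M AH(3,1,2), of L] by blast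
  define h where "h = max (nat \<lceil>H ^ L\<rceil>) (2 ^ L)"
  have h: "H ^ L \<le> real h" "2 ^ L \<le> h" unfolding h_def by (linarith, simp)
  have "1 \<le> h" using h(2) order_trans[OF one_le_power[of "2::nat" L]] by simp
  then have jh: "1 \<le> j * h" "j \<le> j * h" using j by auto
  \<comment> \<open>The constant \<open>D\<close> is built in so that \<open>p \<le> q\<close> holds
    without a further factor.\<close>
  define q where "q f = D * S_seminorm M (j * h) f" for f :: "real ^ 'd \<Rightarrow> complex"
  have q: "continuous_seminorm fun_smul (S_topology M) q"
    unfolding q_def S_topology_def
    by (rule continuous_seminorm_scaled[OF vector_space_fun_smul subspace_S_space[OF M] _ seminorm_on_S_seminorm[OF M]])
      (use jh D in auto)
  have pq: "p f \<le> q f" if "f \<in> ?E" for f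
    using D(2)[OF that] mult_left_mono[OF S_seminorm_mono[OF M that j jh(2)], of D] D(1)
    unfolding q_def by linarith
  define N where "N k = real (((L + 1) * 3) ^ d * (8 ^ d) ^ k)" for k
  define \<epsilon> where "\<epsilon> k = C * (real d ^ 2) ^ L * (1 / 2 ^ L) ^ k" for k
  have "nuclear_map (seq_completion_smul fun_smul) (seq_completion ?E q) (seq_completion_norm q)
      (seq_completion_smul fun_smul) (seq_completion ?E p) (seq_completion_norm p) (\<lambda>u. u)"
  proof (rule nuclear_map_from_kernels[where I = "sampling_set L" and l = "\<lambda>(\<beta>, y) f. multi_deriv \<beta> f y"
        and N = N and \<epsilon> = \<epsilon>, OF vector_space_fun_smul subspace_S_space[OF M] _ _ pq sampling_set(1,3,2)])
    show "seminorm_on fun_smul ?E p" "seminorm_on fun_smul ?E q"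
      using p q by (simp_all add: continuous_seminorm_def top)
    show "bounded_functional fun_smul ?E q (case i of (\<beta>, y) \<Rightarrow> \<lambda>f. multi_deriv \<beta> f y)" for i
      unfolding q_def[abs_def] by (cases i) (simp add: bounded_functional_multi_deriv[OF M jh(1) D(1)])
    show "0 \<le> \<epsilon> k" for k using C(1) by (simp add: \<epsilon>_def)
    show "p f \<le> \<epsilon> k * q f"
      if f: "f \<in> ?E" and "\<And>i. i \<in> sampling_set L k \<Longrightarrow> (case i of (\<beta>, y) \<Rightarrow> \<lambda>f. multi_deriv \<beta> f y) f = 0" for k f
    proof -
      have "multi_deriv \<beta> f y = 0" if "(\<beta>, y) \<in> sampling_set L k" for \<beta> y
        using \<open>\<And>i. i \<in> sampling_set L k \<Longrightarrow> _\<close>[OF that] by simp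
      from S_seminorm_le_of_vanishing[OF M C h j f this]
      have "S_seminorm M j f \<le> \<epsilon> k * S_seminorm M (j * h) f" by (simp add: \<epsilon>_def d_def)
      then have "D * S_seminorm M j f \<le> D * (\<epsilon> k * S_seminorm M (j * h) f)" using D(1) by simp
      then show ?thesis using D(2)[OF f] by (simp add: q_def ac_simps)
    qed
    show "real (card (sampling_set L k :: (('d \<Rightarrow> nat) \<times> (real ^ 'd)) set)) \<le> N k" for k
      unfolding N_def d_def of_nat_le_iff by (rule sampling_set(4))
    show "1 \<le> N k" for k
      unfolding N_def by (simp only: real_of_nat_ge_one_iff) (simp add: Suc_le_eq)
    have "N k * N (Suc k) * \<epsilon> k = N 0 * N 0 * 8 ^ d * (C * (real d ^ 2) ^ L) * (1 / 2) ^ k" for k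
    proof -
      have "(8 ^ d * 8 ^ d * (1 / 2 ^ L) :: real) = 1 / 2"
      proof -
        have "(8 ^ d * 8 ^ d :: real) = 64 ^ d" by (simp flip: power_mult_distrib)
        also have "\<dots> = 2 ^ (6 * d)" by (simp add: power_mult)
        finally show ?thesis by (simp add: L_def)
      qed
      then have "(1 / 2 :: real) ^ k = (8 ^ d) ^ k * (8 ^ d) ^ k * (1 / 2 ^ L) ^ k"
        by (simp flip: power_mult_distrib)
      then show ?thesis by (simp add: N_def \<epsilon>_def ac_simps)
    qed
    moreover have "summable (\<lambda>k. N 0 * N 0 * 8 ^ d * (C * (real d ^ 2) ^ L) * (1 / 2) ^ k)"
      by (intro summable_mult summable_geometric) simp
    ultimately show "summable (\<lambda>k. N k * N (Suc k) * \<epsilon> k)" by presburger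
  qed
  then show "\<exists>q. continuous_seminorm fun_smul (S_topology M) q \<and> (\<forall>f\<in>topspace (S_topology M). p f \<le> q f) \<and>
      nuclear_map (seq_completion_smul fun_smul) (seq_completion (topspace (S_topology M)) q) (seq_completion_norm q)
        (seq_completion_smul fun_smul) (seq_completion (topspace (S_topology M)) p) (seq_completion_norm p) (\<lambda>u. u)"
    unfolding top using q pq by blast
qed

end
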